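(* Let $\mathbb{F}$ be a countable field and let $\mathbf{V}$ be any variety of $\mathbb{F}$-algebras with quasi-inversion such that $R_{\mathbb{F}}\in\mathbf{V}$. Then the following statements hold: (i) There exists no partial Banaschewski function on $\{\tilde{\xi}\mid\xi<\omega_1\}$ in the (unital, regular) ring $\mathcal{R}_{\mathbf{V}}(\omega_1)$. In particular, there is no Banaschewski function on the ring $\mathcal{R}_{\mathbf{V}}(\omega_1)$. (ii) There exists no partial Banaschewski function on $\{\tilde{\xi}\cdot\mathcal{R}_{\mathbf{V}}(\omega_1)\mid\xi<\omega_1\}$ in the (complemented, modular) lattice $\mathbb{L}(\mathcal{R}_{\mathbf{V}}(\omega_1))$. In particular, there is no Banaschewski function on the lattice $\mathbb{L}(\mathcal{R}_{\mathbf{V}}(\omega_1))$.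
   Context: "Countable" means at most countable. For a field $\mathbb{F}$, $\Sigma_{\mathbb{F}}$ is the similarity type with constants $0,1$, binary operations $-$ and $\cdot$, a unary operation $'$, and unary operations $h_\lambda$ ($\lambda\in\mathbb{F}$, multiplication by $\lambda$). $\mathbf{Reg}_{\mathbb{F}}$ is the variety of all unital $\mathbb{F}$-algebras endowed with a unary operation $x\mapsto x'$ satisfying the identity $xx'x=x$; its members are called $\mathbb{F}$-algebras with quasi-inversion. A variety of $\mathbb{F}$-algebras with quasi-inversion is a class of $\Sigma_{\mathbb{F}}$-structures defined by a set of identities and contained in $\mathbf{Reg}_{\mathbb{F}}$. For such a variety $\mathbf{V}$ and a chain $\Lambda$, $\mathcal{R}_{\mathbf{V}}(\Lambda)$ is the $\mathbf{V}$-object defined by generators $\tilde{\alpha}$ ($\alpha\in\Lambda$) and relations $\tilde{\alpha}=\tilde{\beta}\cdot\tilde{\alpha}$ for all $\alpha\le\beta$ in $\Lambda$. Here $\omega_1$ is the first uncountable ordinal, viewed as a chain. Definition of $R_{\mathbb{F}}$: in $\mathbb{F}^{3\times3}$ let $A=\begin{pmatrix}1&0&0\\0&0&0\\0&0&0\end{pmatrix}$, $B=\begin{pmatrix}1&0&1\\0&1&0\\0&0&0\end{pmatrix}$, $I$ the identity matrix; let $\mathbb{F}[M]$ be the unital $\mathbb{F}$-subalgebra generated by $M$. One has $\mathbb{F}[A]\cap\mathbb{F}[B]=\mathbb{F}\cdot I$. For each $X\in\mathbb{F}^{3\times3}$ fix a quasi-inverse $X'$ of $X$ (i.e. $XX'X=X$)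 lying in the smallest member of $\{\mathbb{F}\cdot I,\mathbb{F}[A],\mathbb{F}[B],\mathbb{F}^{3\times3}\}$ containing $X$. $R_{\mathbb{F}}$ is $\mathbb{F}^{3\times3}$ endowed with this (fixed) quasi-inversion. For a regular ring $R$, $\mathbb{L}(R):=\{xR\mid x\in R\}$, ordered by inclusion, is the lattice of principal right ideals. For idempotents $a,b$ of a ring, $a\trianglelefteq b$ means $a=ab=ba$. For a subset $X$ of a ring $R$, a partial Banaschewski function on $X$ in $R$ is a map $\varepsilon$ from $X$ to the set of idempotents of $R$ such that $xR=\varepsilon(x)R$ for each $x\in X$, and $xR\subseteq yR$ implies $\varepsilon(x)\trianglelefteq\varepsilon(y)$ for all $x,y\in X$; if $X=R$ it is called a Banaschewski function on $R$. For a subset $X$ of a bounded lattice $L$, a partial Banaschewski function on $X$ in $L$ is an antitone map $f\colon X\to L$ with $x\wedge f(x)=0$ and $x\vee f(x)=1$ for each $x\in X$; if $X=L$ it is called a Banaschewski function on $L$. *)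

theory Defs
  imports
    "HOL-Analysis.Finite_Cartesian_Product"
    "HOL-Algebra.Ring"
    "HOL-Algebra.Lattice"
    "HOL-Library.Countable_Set"
begin

section \<open>Structures, terms and identities of the similarity type\<close>

text \<open>
  The scalar field is the type \<open>'f\<close>. The signature has no symbol for addition; it is the derived
  operation \<open>x - (0 - y)\<close>.
\<close>

record ('a, 'f) sig_struct = "'a partial_object" +
  szero :: 'a
  sone :: 'a
  sminus :: "'a \<Rightarrow> 'a \<Rightarrow> 'a"
  stimes :: "'a \<Rightarrow> 'a \<Rightarrow> 'a"
  sqinv :: "'a \<Rightarrow> 'a"
  sscale :: "'f \<Rightarrow> 'a \<Rightarrow> 'a"

definition is_sig_struct :: "('a, 'f) sig_struct \<Rightarrow> bool" where
  "is_sig_struct S \<longleftrightarrow>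
     szero S \<in> carrier S \<and> sone S \<in> carrier S \<and>
     (\<forall>x\<in>carrier S. \<forall>y\<in>carrier S. sminus S x y \<in> carrier S) \<and>
     (\<forall>x\<in>carrier S. \<forall>y\<in>carrier S. stimes S x y \<in> carrier S) \<and>
     (\<forall>x\<in>carrier S. sqinv S x \<in> carrier S) \<and>
     (\<forall>c. \<forall>x\<in>carrier S. sscale S c x \<in> carrier S)"

datatype (dead 'f, vars: 'v) tm =
    Var 'v
  | TZero
  | TOne
  | TMinus "('f, 'v) tm" "('f, 'v) tm"
  | TTimes "('f, 'v) tm" "('f, 'v) tm"
  | TQinv "('f, 'v) tm"
  | TScale 'f "('f, 'v) tm"

primrec eval :: "('a, 'f) sig_struct \<Rightarrow> ('v \<Rightarrow> 'a) \<Rightarrow> ('f, 'v) tm \<Rightarrow> 'a" where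
  "eval S v (Var x) = v x"
| "eval S v TZero = szero S"
| "eval S v TOne = sone S"
| "eval S v (TMinus s t) = sminus S (eval S v s) (eval S v t)"
| "eval S v (TTimes s t) = stimes S (eval S v s) (eval S v t)"
| "eval S v (TQinv s) = sqinv S (eval S v s)"
| "eval S v (TScale c s) = sscale S c (eval S v s)"

primrec subst :: "('v \<Rightarrow> ('f, 'w) tm) \<Rightarrow> ('f, 'v) tm \<Rightarrow> ('f, 'w) tm" where
  "subst \<sigma> (Var x) = \<sigma> x"
| "subst \<sigma> TZero = TZero"
| "subst \<sigma> TOne = TOne"
| "subst \<sigma> (TMinus s t) = TMinus (subst \<sigma> s) (subst \<sigma> t)"
| "subst \<sigma> (TTimes s t) = TTimes (subst \<sigma> s) (subst \<sigma> t)"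
| "subst \<sigma> (TQinv s) = TQinv (subst \<sigma> s)"
| "subst \<sigma> (TScale c s) = TScale c (subst \<sigma> s)"

text \<open>An identity is a pair of terms in the variables \<open>Var 0, Var 1, \<dots>\<close>; \<open>Mod E\<close> is the class of all
  structures (here: on subsets of the type \<open>'a\<close>) satisfying the identities in \<open>E\<close>.\<close>

definition Mod :: "('f, nat) tm rel \<Rightarrow> ('a, 'f) sig_struct set" where
  "Mod E = {S. is_sig_struct S \<and>
     (\<forall>(s, t)\<in>E. \<forall>v. range v \<subseteq> carrier S \<longrightarrow> eval S v s = eval S v t)}"


section \<open>Algebras with quasi-inversion and their varieties\<close>

definition ring_of :: "('a, 'f) sig_struct \<Rightarrow> 'a ring" where
  "ring_of S = \<lparr>carrier = carrier S, monoid.mult = stimes S, one = sone S, zero = szero S,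
     add = (\<lambda>x y. sminus S x (sminus S (szero S) y))\<rparr>"

definition Reg :: "('a, 'f::field) sig_struct set" where
  "Reg = {S. is_sig_struct S \<and> ring (ring_of S) \<and>
     (\<forall>x\<in>carrier S. \<forall>y\<in>carrier S. sminus S x y = x \<ominus>\<^bsub>ring_of S\<^esub> y) \<and>
     (\<forall>c. \<forall>x\<in>carrier S. \<forall>y\<in>carrier S.
        sscale S c (x \<oplus>\<^bsub>ring_of S\<^esub> y) = sscale S c x \<oplus>\<^bsub>ring_of S\<^esub> sscale S c y) \<and>
     (\<forall>c d. \<forall>x\<in>carrier S. sscale S (c + d) x = sscale S c x \<oplus>\<^bsub>ring_of S\<^esub> sscale S d x) \<and>
     (\<forall>c d. \<forall>x\<in>carrier S. sscale S (c * d) x = sscale S c (sscale S d x)) \<and>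
     (\<forall>x\<in>carrier S. sscale S 1 x = x) \<and>
     (\<forall>c. \<forall>x\<in>carrier S. \<forall>y\<in>carrier S.
        sscale S c (x \<otimes>\<^bsub>ring_of S\<^esub> y) = sscale S c x \<otimes>\<^bsub>ring_of S\<^esub> y \<and>
        sscale S c (x \<otimes>\<^bsub>ring_of S\<^esub> y) = x \<otimes>\<^bsub>ring_of S\<^esub> sscale S c y) \<and>
     (\<forall>x\<in>carrier S. x \<otimes>\<^bsub>ring_of S\<^esub> sqinv S x \<otimes>\<^bsub>ring_of S\<^esub> x = x)}"

text \<open>
  A variety is given by a set \<open>E\<close> of identities. HOL cannot quantify over all types inside a formula,
  so the inclusion of the variety in \<open>Reg\<close> is required for structures on one fixed type, large
  enough to carry the free algebra of the variety on countably many generators; the inclusion on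
  every other type then follows (lemma \<open>Mod_subset_Reg\<close> below).
\<close>

definition qinv_variety :: "('f::field, nat) tm rel \<Rightarrow> bool" where
  "qinv_variety E \<longleftrightarrow> (Mod E :: (('f, nat) tm set, 'f) sig_struct set) \<subseteq> Reg"


section \<open>Generators and relations\<close>

definition terms_over :: "'v set \<Rightarrow> ('f, 'v) tm set" where
  "terms_over G = {t. vars t \<subseteq> G}"

text \<open>The least congruence on the algebra of terms over \<open>G\<close> that contains the defining relations \<open>R\<close>
  and whose quotient satisfies the identities \<open>E\<close>.\<close>

inductive pres_cong ::
  "('f, nat) tm rel \<Rightarrow> 'v set \<Rightarrow> ('f, 'v) tm rel \<Rightarrow> ('f, 'v) tm \<Rightarrow> ('f, 'v) tm \<Rightarrow> bool"
  for E G R where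
  refl: "t \<in> terms_over G \<Longrightarrow> pres_cong E G R t t"
| sym: "pres_cong E G R s t \<Longrightarrow> pres_cong E G R t s"
| trans: "pres_cong E G R s t \<Longrightarrow> pres_cong E G R t u \<Longrightarrow> pres_cong E G R s u"
| rel: "(s, t) \<in> R \<Longrightarrow> s \<in> terms_over G \<Longrightarrow> t \<in> terms_over G \<Longrightarrow> pres_cong E G R s t"
| ident: "(s, t) \<in> E \<Longrightarrow> range \<sigma> \<subseteq> terms_over G \<Longrightarrow> pres_cong E G R (subst \<sigma> s) (subst \<sigma> t)"
| minus: "pres_cong E G R s s' \<Longrightarrow> pres_cong E G R t t' \<Longrightarrow>
    pres_cong E G R (TMinus s t) (TMinus s' t')"
| times: "pres_cong E G R s s' \<Longrightarrow> pres_cong E G R t t' \<Longrightarrow>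
    pres_cong E G R (TTimes s t) (TTimes s' t')"
| qinv: "pres_cong E G R s s' \<Longrightarrow> pres_cong E G R (TQinv s) (TQinv s')"
| scale: "pres_cong E G R s s' \<Longrightarrow> pres_cong E G R (TScale c s) (TScale c s')"

definition pres_rel :: "('f, nat) tm rel \<Rightarrow> 'v set \<Rightarrow> ('f, 'v) tm rel \<Rightarrow> ('f, 'v) tm rel" where
  "pres_rel E G R = {(s, t). pres_cong E G R s t}"

definition presented ::
  "('f, nat) tm rel \<Rightarrow> 'v set \<Rightarrow> ('f, 'v) tm rel \<Rightarrow> (('f, 'v) tm set, 'f) sig_struct" where
  "presented E G R =
    (let \<rho> = pres_rel E G R in
     \<lparr>carrier = terms_over G // \<rho>,
      szero = \<rho> `` {TZero},
      sone = \<rho> `` {TOne},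
      sminus = (\<lambda>X Y. \<Union>s\<in>X. \<Union>t\<in>Y. \<rho> `` {TMinus s t}),
      stimes = (\<lambda>X Y. \<Union>s\<in>X. \<Union>t\<in>Y. \<rho> `` {TTimes s t}),
      sqinv = (\<lambda>X. \<Union>s\<in>X. \<rho> `` {TQinv s}),
      sscale = (\<lambda>c X. \<Union>s\<in>X. \<rho> `` {TScale c s})\<rparr>)"

text \<open>A chain is a reflexive linear order \<open>r\<close> with underlying set \<open>Field r\<close>.\<close>

definition chain_rels :: "'i rel \<Rightarrow> ('f, 'i) tm rel" where
  "chain_rels r = {(Var \<alpha>, TTimes (Var \<beta>) (Var \<alpha>)) | \<alpha> \<beta>. (\<alpha>, \<beta>) \<in> r}"

definition RV :: "('f, nat) tm rel \<Rightarrow> 'i rel \<Rightarrow> (('f, 'i) tm set, 'f) sig_struct" where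
  "RV E r = presented E (Field r) (chain_rels r)"

definition tilde :: "('f, nat) tm rel \<Rightarrow> 'i rel \<Rightarrow> 'i \<Rightarrow> ('f, 'i) tm set" where
  "tilde E r \<xi> = pres_rel E (Field r) (chain_rels r) `` {Var \<xi>}"

text \<open>\<open>cardSuc natLeq\<close> is a well-order of cardinality \<open>\<aleph>\<^sub>1\<close> each of whose proper initial segments is
  countable, i.e. a copy of the first uncountable ordinal.\<close>

definition omega1 :: "nat set rel" where
  "omega1 = cardSuc natLeq"


section \<open>The algebra of 3 by 3 matrices\<close>

text \<open>The product of matrices is \<open>**\<close>; the overloaded \<open>*\<close> would be the entrywise product.\<close>

definition mscale :: "'f::field \<Rightarrow> 'f^3^3 \<Rightarrow> 'f^3^3" where
  "mscale c X = map_matrix ((*) c) X"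

definition matA :: "'f::field^3^3" where
  "matA = (\<chi> i j. if i = 1 \<and> j = 1 then 1 else 0)"

definition matB :: "'f::field^3^3" where
  "matB = (\<chi> i j. if (i, j) \<in> {(1, 1), (1, 3), (2, 2)} then 1 else 0)"

definition unital_subalgebra :: "('f::field^3^3) set \<Rightarrow> bool" where
  "unital_subalgebra T \<longleftrightarrow> mat 1 \<in> T \<and>
     (\<forall>X\<in>T. \<forall>Y\<in>T. X + Y \<in> T \<and> X ** Y \<in> T) \<and> (\<forall>c. \<forall>X\<in>T. mscale c X \<in> T)"

definition gen_subalgebra :: "'f::field^3^3 \<Rightarrow> ('f^3^3) set" where
  "gen_subalgebra M = \<Inter>{T. unital_subalgebra T \<and> M \<in> T}"

definition scalar_matrices :: "('f::field^3^3) set" where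
  "scalar_matrices = range (\<lambda>c. mscale c (mat 1))"

definition RF_quasi_inversion :: "('f::field^3^3 \<Rightarrow> 'f^3^3) \<Rightarrow> bool" where
  "RF_quasi_inversion q \<longleftrightarrow> (\<forall>X. X ** q X ** X = X \<and>
     (let \<C> = {scalar_matrices, gen_subalgebra matA, gen_subalgebra matB, UNIV} in
      \<exists>T\<in>\<C>. X \<in> T \<and> (\<forall>T'\<in>\<C>. X \<in> T' \<longrightarrow> T \<subseteq> T') \<and> q X \<in> T))"

definition RF :: "('f::field^3^3 \<Rightarrow> 'f^3^3) \<Rightarrow> ('f^3^3, 'f) sig_struct" where
  "RF q = \<lparr>carrier = UNIV, szero = 0, sone = mat 1, sminus = (-), stimes = (**),
     sqinv = q, sscale = mscale\<rparr>"


section \<open>Banaschewski functions\<close>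

definition regular_ring :: "('a, 'm) ring_scheme \<Rightarrow> bool" where
  "regular_ring R \<longleftrightarrow>
     ring R \<and> (\<forall>x\<in>carrier R. \<exists>y\<in>carrier R. x \<otimes>\<^bsub>R\<^esub> y \<otimes>\<^bsub>R\<^esub> x = x)"

definition right_ideal :: "('a, 'm) ring_scheme \<Rightarrow> 'a \<Rightarrow> 'a set" where
  "right_ideal R x = {x \<otimes>\<^bsub>R\<^esub> y | y. y \<in> carrier R}"

definition idempotents :: "('a, 'm) ring_scheme \<Rightarrow> 'a set" where
  "idempotents R = {e \<in> carrier R. e \<otimes>\<^bsub>R\<^esub> e = e}"

definition idem_le :: "('a, 'm) ring_scheme \<Rightarrow> 'a \<Rightarrow> 'a \<Rightarrow> bool" where
  "idem_le R a b \<longleftrightarrow> a = a \<otimes>\<^bsub>R\<^esub> b \<and> a = b \<otimes>\<^bsub>R\<^esub> a"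

definition ring_partial_Banaschewski ::
  "('a, 'm) ring_scheme \<Rightarrow> 'a set \<Rightarrow> ('a \<Rightarrow> 'a) \<Rightarrow> bool" where
  "ring_partial_Banaschewski R X \<epsilon> \<longleftrightarrow>
     (\<forall>x\<in>X. \<epsilon> x \<in> idempotents R) \<and>
     (\<forall>x\<in>X. right_ideal R x = right_ideal R (\<epsilon> x)) \<and>
     (\<forall>x\<in>X. \<forall>y\<in>X. right_ideal R x \<subseteq> right_ideal R y \<longrightarrow> idem_le R (\<epsilon> x) (\<epsilon> y))"

definition ring_Banaschewski :: "('a, 'm) ring_scheme \<Rightarrow> ('a \<Rightarrow> 'a) \<Rightarrow> bool" where
  "ring_Banaschewski R \<epsilon> \<longleftrightarrow> ring_partial_Banaschewski R (carrier R) \<epsilon>"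

definition ideal_lattice :: "('a, 'm) ring_scheme \<Rightarrow> 'a set gorder" where
  "ideal_lattice R = \<lparr>carrier = right_ideal R ` carrier R, eq = (=), le = (\<subseteq>)\<rparr>"

definition lattice_partial_Banaschewski ::
  "('a, 'm) gorder_scheme \<Rightarrow> 'a set \<Rightarrow> ('a \<Rightarrow> 'a) \<Rightarrow> bool" where
  "lattice_partial_Banaschewski L X f \<longleftrightarrow>
     (\<forall>x\<in>X. f x \<in> carrier L) \<and>
     (\<forall>x\<in>X. \<forall>y\<in>X. x \<sqsubseteq>\<^bsub>L\<^esub> y \<longrightarrow> f y \<sqsubseteq>\<^bsub>L\<^esub> f x) \<and>
     (\<forall>x\<in>X. x \<sqinter>\<^bsub>L\<^esub> f x = \<bottom>\<^bsub>L\<^esub> \<and> x \<squnion>\<^bsub>L\<^esub> f x = \<top>\<^bsub>L\<^esub>)"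

definition lattice_Banaschewski :: "('a, 'm) gorder_scheme \<Rightarrow> ('a \<Rightarrow> 'a) \<Rightarrow> bool" where
  "lattice_Banaschewski L f \<longleftrightarrow> lattice_partial_Banaschewski L (carrier L) f"


section \<open>Adequacy of the definitions\<close>

subsection \<open>Generators and relations\<close>

lemma is_sig_structD:
  assumes "is_sig_struct S"
  shows "szero S \<in> carrier S" "sone S \<in> carrier S"
    and "x \<in> carrier S \<Longrightarrow> y \<in> carrier S \<Longrightarrow> sminus S x y \<in> carrier S"
    and "x \<in> carrier S \<Longrightarrow> y \<in> carrier S \<Longrightarrow> stimes S x y \<in> carrier S"
    and "x \<in> carrier S \<Longrightarrow> sqinv S x \<in> carrier S"
    and "x \<in> carrier S \<Longrightarrow> sscale S c x \<in> carrier S"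
  using assms unfolding is_sig_struct_def by blast+

lemma eval_subst: "eval S v (subst \<sigma> t) = eval S (\<lambda>n. eval S v (\<sigma> n)) t"
  by (induction t) auto

lemma eval_closed:
  assumes "is_sig_struct S" "v ` G \<subseteq> carrier S" "t \<in> terms_over G"
  shows "eval S v t \<in> carrier S"
  using assms(3)
proof (induction t)
  case (Var x)
  then show ?case using assms(2) by (auto simp: terms_over_def)
qed (auto simp: terms_over_def is_sig_structD[OF assms(1)])

lemma subst_closed: "range \<sigma> \<subseteq> terms_over G \<Longrightarrow> subst \<sigma> t \<in> terms_over G"
  by (induction t) (auto simp: terms_over_def)

lemma pres_cong_terms:
  "pres_cong E G R s t \<Longrightarrow> s \<in> terms_over G \<and> t \<in> terms_over G"
proof (induction rule: pres_cong.induct)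
  case (ident s t \<sigma>)
  then show ?case using subst_closed by blast
qed (auto simp: terms_over_def)

lemma pres_cong_sound:
  assumes S: "S \<in> Mod E" and v: "v ` G \<subseteq> carrier S"
    and R: "\<And>s t. (s, t) \<in> R \<Longrightarrow> eval S v s = eval S v t"
    and "pres_cong E G R s t"
  shows "eval S v s = eval S v t"
  using assms(4)
proof (induction rule: pres_cong.induct)
  case (ident s t \<sigma>)
  have "is_sig_struct S" using S by (simp add: Mod_def)
  then have "range (\<lambda>n. eval S v (\<sigma> n)) \<subseteq> carrier S"
    using ident v eval_closed by blast
  then show ?case using S ident by (auto simp: Mod_def eval_subst)
qed (auto simp: R)

lemma equiv_pres_rel: "equiv (terms_over G) (pres_rel E G R)"
proof (rule equivI)
  show "pres_rel E G R \<subseteq> terms_over G \<times> terms_over G"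
    by (auto simp: pres_rel_def dest: pres_cong_terms)
  show "refl_on (terms_over G) (pres_rel E G R)"
    by (auto simp: refl_on_def pres_rel_def intro: pres_cong.refl)
  show "sym (pres_rel E G R)" by (auto simp: sym_def pres_rel_def intro: pres_cong.sym)
  show "trans (pres_rel E G R)" by (auto simp: trans_def pres_rel_def intro: pres_cong.trans)
qed

lemma pres_class_eq:
  assumes "s \<in> terms_over G" "t \<in> terms_over G"
  shows "pres_rel E G R `` {s} = pres_rel E G R `` {t} \<longleftrightarrow> pres_cong E G R s t"
  using eq_equiv_class_iff[OF equiv_pres_rel assms] by (simp add: pres_rel_def)

lemma presented_ops:
  fixes E :: "('f, nat) tm rel" and R :: "('f, 'v) tm rel"
  assumes s: "s \<in> terms_over G" and t: "t \<in> terms_over G"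
  defines "c \<equiv> \<lambda>t. pres_rel E G R `` {t}"
  shows "sminus (presented E G R) (c s) (c t) = c (TMinus s t)"
    and "stimes (presented E G R) (c s) (c t) = c (TTimes s t)"
    and "sqinv (presented E G R) (c s) = c (TQinv s)"
    and "sscale (presented E G R) a (c s) = c (TScale a s)"
proof -
  have c: "c u = c u' " if "pres_cong E G R u u'" for u u'
    using that pres_cong_terms[OF that] pres_class_eq unfolding c_def by blast
  have mem: "u \<in> c s' \<longleftrightarrow> pres_cong E G R s' u" for u s'
    by (simp add: c_def pres_rel_def)
  have self: "s \<in> c s" "t \<in> c t" using s t mem pres_cong.refl by blast+
  have Us: "(\<Union>u\<in>c s. F u) = K" if "\<And>u. pres_cong E G R s u \<Longrightarrow> F u = K" for F :: "_ \<Rightarrow> ('f, 'v) tm set" and K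
    by (rule SUP_eq_const) (use self(1) mem that in auto)
  have Ut: "(\<Union>u\<in>c t. F u) = K" if "\<And>u. pres_cong E G R t u \<Longrightarrow> F u = K" for F :: "_ \<Rightarrow> ('f, 'v) tm set" and K
    by (rule SUP_eq_const) (use self(2) mem that in auto)
  have "(\<Union>u\<in>c s. \<Union>w\<in>c t. c (TMinus u w)) = c (TMinus s t)"
    by (intro Us Ut c pres_cong.sym[OF pres_cong.minus])
  then show "sminus (presented E G R) (c s) (c t) = c (TMinus s t)"
    by (simp add: presented_def Let_def c_def)
  have "(\<Union>u\<in>c s. \<Union>w\<in>c t. c (TTimes u w)) = c (TTimes s t)"
    by (intro Us Ut c pres_cong.sym[OF pres_cong.times])
  then show "stimes (presented E G R) (c s) (c t) = c (TTimes s t)"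
    by (simp add: presented_def Let_def c_def)
  have "(\<Union>u\<in>c s. c (TQinv u)) = c (TQinv s)"
    by (intro Us c pres_cong.sym[OF pres_cong.qinv])
  then show "sqinv (presented E G R) (c s) = c (TQinv s)"
    by (simp add: presented_def Let_def c_def)
  have "(\<Union>u\<in>c s. c (TScale a u)) = c (TScale a s)"
    by (intro Us c pres_cong.sym[OF pres_cong.scale])
  then show "sscale (presented E G R) a (c s) = c (TScale a s)"
    by (simp add: presented_def Let_def c_def)
qed

lemma presented_consts:
  "carrier (presented E G R) = terms_over G // pres_rel E G R"
  "szero (presented E G R) = pres_rel E G R `` {TZero}"
  "sone (presented E G R) = pres_rel E G R `` {TOne}"
  by (simp_all add: presented_def Let_def)

lemma eval_presented:
  assumes "\<And>x. x \<in> vars t \<Longrightarrow> \<sigma> x \<in> terms_over G"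
  shows "subst \<sigma> t \<in> terms_over G \<and>
    eval (presented E G R) (\<lambda>x. pres_rel E G R `` {\<sigma> x}) t = pres_rel E G R `` {subst \<sigma> t}"
  using assms
  by (induction t) (auto simp: presented_ops presented_consts, auto simp: terms_over_def)

lemma presented_in_Mod: "presented E G R \<in> Mod E"
proof -
  let ?P = "presented E G R" and ?c = "\<lambda>t. pres_rel E G R `` {t}"
  have car: "X \<in> carrier ?P \<longleftrightarrow> (\<exists>t\<in>terms_over G. X = ?c t)" for X
    by (auto simp: presented_consts quotient_def)
  have "is_sig_struct ?P"
    unfolding is_sig_struct_def car
  proof (intro conjI ballI allI)
    show "\<exists>t\<in>terms_over G. szero ?P = ?c t" "\<exists>t\<in>terms_over G. sone ?P = ?c t"
      by (auto simp: presented_consts terms_over_def intro: exI[of _ TZero] exI[of _ TOne])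
  next
    fix X Y assume "X \<in> carrier ?P" "Y \<in> carrier ?P"
    then obtain s t where st: "s \<in> terms_over G" "t \<in> terms_over G" "X = ?c s" "Y = ?c t"
      using car by auto
    have "TMinus s t \<in> terms_over G" "TTimes s t \<in> terms_over G"
      using st(1,2) by (auto simp: terms_over_def)
    then show "\<exists>t\<in>terms_over G. sminus ?P X Y = ?c t" "\<exists>t\<in>terms_over G. stimes ?P X Y = ?c t"
      unfolding st(3,4) presented_ops[OF st(1,2)] by blast+
  next
    fix X a assume "X \<in> carrier ?P"
    then obtain s where st: "s \<in> terms_over G" "X = ?c s" using car by auto
    have "TQinv s \<in> terms_over G" "TScale a s \<in> terms_over G"
      using st(1) by (auto simp: terms_over_def)
    then show "\<exists>t\<in>terms_over G. sqinv ?P X = ?c t" "\<exists>t\<in>terms_over G. sscale ?P a X = ?c t"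
      unfolding st(2) presented_ops[OF st(1,1)] by blast+
  qed
  moreover have "eval ?P v s = eval ?P v t"
    if st: "(s, t) \<in> E" and v: "range v \<subseteq> carrier ?P" for s t v
  proof -
    have "\<forall>n. \<exists>u. u \<in> terms_over G \<and> v n = ?c u" using v car by blast
    then obtain \<sigma> where \<sigma>: "\<And>n. \<sigma> n \<in> terms_over G" "\<And>n. v n = ?c (\<sigma> n)" by metis
    have veq: "v = (\<lambda>n. ?c (\<sigma> n))" using \<sigma>(2) by auto
    have "pres_cong E G R (subst \<sigma> s) (subst \<sigma> t)"
      by (rule pres_cong.ident) (use st \<sigma> in auto)
    then have "?c (subst \<sigma> s) = ?c (subst \<sigma> t)"
      using pres_class_eq pres_cong_terms by blast
    then show ?thesis unfolding veq using eval_presented \<sigma>(1) by metis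
  qed
  ultimately show ?thesis by (auto simp: Mod_def)
qed

definition sig_hom :: "('a, 'f) sig_struct \<Rightarrow> ('b, 'f) sig_struct \<Rightarrow> ('a \<Rightarrow> 'b) \<Rightarrow> bool" where
  "sig_hom S T h \<longleftrightarrow>
     (\<forall>x\<in>carrier S. h x \<in> carrier T) \<and> h (szero S) = szero T \<and> h (sone S) = sone T \<and>
     (\<forall>x\<in>carrier S. \<forall>y\<in>carrier S. h (sminus S x y) = sminus T (h x) (h y)) \<and>
     (\<forall>x\<in>carrier S. \<forall>y\<in>carrier S. h (stimes S x y) = stimes T (h x) (h y)) \<and>
     (\<forall>x\<in>carrier S. h (sqinv S x) = sqinv T (h x)) \<and>
     (\<forall>c. \<forall>x\<in>carrier S. h (sscale S c x) = sscale T c (h x))"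

lemma presented_universal:
  fixes S :: "('a, 'f) sig_struct"
  assumes S: "S \<in> Mod E" and v: "v ` G \<subseteq> carrier S"
    and R: "\<And>s t. (s, t) \<in> R \<Longrightarrow> eval S v s = eval S v t"
  shows "\<exists>h. sig_hom (presented E G R) S h \<and> (\<forall>g\<in>G. h (pres_rel E G R `` {Var g}) = v g)"
proof -
  let ?P = "presented E G R" and ?c = "\<lambda>t. pres_rel E G R `` {t}"
  define h where "h X = eval S v (SOME t. t \<in> X)" for X
  have h: "h (?c t) = eval S v t" if "t \<in> terms_over G" for t
  proof -
    have "t \<in> ?c t" using that by (simp add: pres_rel_def pres_cong.refl)
    then have "(SOME t'. t' \<in> ?c t) \<in> ?c t" by (rule someI)
    then have "pres_cong E G R t (SOME t'. t' \<in> ?c t)" by (simp add: pres_rel_def)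
    from pres_cong_sound[OF S v R this] show ?thesis by (simp add: h_def)
  qed
  have car: "X \<in> carrier ?P \<longleftrightarrow> (\<exists>t\<in>terms_over G. X = ?c t)" for X
    by (auto simp: presented_consts quotient_def)
  have sS: "is_sig_struct S" using S by (simp add: Mod_def)
  have t: "TZero \<in> terms_over G" "TOne \<in> terms_over G"
    "\<And>s t. s \<in> terms_over G \<Longrightarrow> t \<in> terms_over G \<Longrightarrow> TMinus s t \<in> terms_over G"
    "\<And>s t. s \<in> terms_over G \<Longrightarrow> t \<in> terms_over G \<Longrightarrow> TTimes s t \<in> terms_over G"
    "\<And>s. s \<in> terms_over G \<Longrightarrow> TQinv s \<in> terms_over G"
    "\<And>s c. s \<in> terms_over G \<Longrightarrow> TScale c s \<in> terms_over G"
    "\<And>g. g \<in> G \<Longrightarrow> Var g \<in> terms_over G"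
    by (auto simp: terms_over_def)
  have "sig_hom ?P S h"
    unfolding sig_hom_def Ball_def car
    by (auto simp: presented_ops presented_consts(2,3) h t eval_closed[OF sS v])
  moreover have "\<forall>g\<in>G. h (?c (Var g)) = v g" by (simp add: h t)
  ultimately show ?thesis by blast
qed

lemma presented_universal_unique:
  assumes "sig_hom (presented E G R) S h" "sig_hom (presented E G R) S k"
    and "\<And>g. g \<in> G \<Longrightarrow> h (pres_rel E G R `` {Var g}) = k (pres_rel E G R `` {Var g})"
    and "X \<in> carrier (presented E G R)"
  shows "h X = k X"
proof -
  let ?P = "presented E G R" and ?c = "\<lambda>t. pres_rel E G R `` {t}"
  have cl: "?c t \<in> carrier ?P" if "t \<in> terms_over G" for t
    using that by (auto simp: presented_consts quotient_def)
  have "h (?c t) = k (?c t)" if "t \<in> terms_over G" for t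
    using that
  proof (induction t)
    case (Var x) then show ?case using assms(3) by (simp add: terms_over_def)
  next
    case TZero then show ?case using assms(1,2) by (simp add: sig_hom_def presented_consts)
  next
    case TOne then show ?case using assms(1,2) by (simp add: sig_hom_def presented_consts)
  next
    case (TMinus s t)
    then have st: "s \<in> terms_over G" "t \<in> terms_over G" by (auto simp: terms_over_def)
    show ?case unfolding presented_ops(1)[OF st, symmetric]
      using assms(1,2) cl[OF st(1)] cl[OF st(2)] TMinus.IH st by (simp add: sig_hom_def)
  next
    case (TTimes s t)
    then have st: "s \<in> terms_over G" "t \<in> terms_over G" by (auto simp: terms_over_def)
    show ?case unfolding presented_ops(2)[OF st, symmetric]
      using assms(1,2) cl[OF st(1)] cl[OF st(2)] TTimes.IH st by (simp add: sig_hom_def)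
  next
    case (TQinv s)
    then have st: "s \<in> terms_over G" by (auto simp: terms_over_def)
    show ?case unfolding presented_ops(3)[OF st st, symmetric]
      using assms(1,2) cl[OF st] TQinv.IH st by (simp add: sig_hom_def)
  next
    case (TScale a s)
    then have st: "s \<in> terms_over G" by (auto simp: terms_over_def)
    show ?case unfolding presented_ops(4)[OF st st, symmetric]
      using assms(1,2) cl[OF st] TScale.IH st by (simp add: sig_hom_def)
  qed
  then show ?thesis using assms(4) by (auto simp: presented_consts quotient_def)
qed


subsection \<open>Inclusion in \<open>Reg\<close> on every type\<close>

definition splus :: "('a, 'f) sig_struct \<Rightarrow> 'a \<Rightarrow> 'a \<Rightarrow> 'a" where
  "splus S x y = sminus S x (sminus S (szero S) y)"

lemma ring_of_simps:
  "carrier (ring_of S) = carrier S" "monoid.mult (ring_of S) = stimes S"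
  "one (ring_of S) = sone S" "zero (ring_of S) = szero S" "add (ring_of S) = splus S"
  by (auto simp: ring_of_def splus_def fun_eq_iff)

definition TPlus :: "('f, 'v) tm \<Rightarrow> ('f, 'v) tm \<Rightarrow> ('f, 'v) tm" where
  "TPlus s t = TMinus s (TMinus TZero t)"

lemma eval_TPlus: "eval S v (TPlus s t) = splus S (eval S v s) (eval S v t)"
  by (simp add: TPlus_def splus_def)

text \<open>The identities defining \<open>Reg\<close>.\<close>

definition Reg_ids :: "('f::field, nat) tm rel" where
  "Reg_ids =
    (let x = Var 0; y = Var 1; z = Var 2 in
      {(TPlus (TPlus x y) z, TPlus x (TPlus y z)), (TPlus x y, TPlus y x), (TPlus TZero x, x),
       (TPlus (TMinus TZero x) x, TZero), (TMinus x y, TPlus x (TMinus TZero y)),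
       (TTimes (TTimes x y) z, TTimes x (TTimes y z)), (TTimes TOne x, x), (TTimes x TOne, x),
       (TTimes (TPlus x y) z, TPlus (TTimes x z) (TTimes y z)),
       (TTimes z (TPlus x y), TPlus (TTimes z x) (TTimes z y)),
       (TScale 1 x, x), (TTimes (TTimes x (TQinv x)) x, x)} \<union>
      (\<Union>c. \<Union>d.
        {(TScale c (TPlus x y), TPlus (TScale c x) (TScale c y)),
         (TScale (c + d) x, TPlus (TScale c x) (TScale d x)),
         (TScale (c * d) x, TScale c (TScale d x)),
         (TScale c (TTimes x y), TTimes (TScale c x) y),
         (TScale c (TTimes x y), TTimes x (TScale c y))}))"

lemma Reg_iff:
  "S \<in> Reg \<longleftrightarrow> is_sig_struct S \<and> (\<forall>(s, t)\<in>Reg_ids. \<forall>v. range v \<subseteq> carrier S \<longrightarrow> eval S v s = eval S v t)"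
  (is "_ \<longleftrightarrow> _ \<and> ?Q")
  for S :: "('a, 'f::field) sig_struct"
proof -
  have Q: "?Q \<longleftrightarrow>
    (\<forall>x\<in>carrier S. \<forall>y\<in>carrier S. \<forall>z\<in>carrier S.
       splus S (splus S x y) z = splus S x (splus S y z) \<and>
       stimes S (stimes S x y) z = stimes S x (stimes S y z) \<and>
       stimes S (splus S x y) z = splus S (stimes S x z) (stimes S y z) \<and>
       stimes S z (splus S x y) = splus S (stimes S z x) (stimes S z y)) \<and>
    (\<forall>x\<in>carrier S. \<forall>y\<in>carrier S. 
       splus S x y = splus S y x \<and> sminus S x y = splus S x (sminus S (szero S) y)) \<and>
    (\<forall>x\<in>carrier S. splus S (szero S) x = x \<and> splus S (sminus S (szero S) x) x = szero S \<and>
       stimes S (sone S) x = x \<and> stimes S x (sone S) = x \<and>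
       sscale S 1 x = x \<and> stimes S (stimes S x (sqinv S x)) x = x) \<and>
    (\<forall>c. \<forall>x\<in>carrier S. \<forall>y\<in>carrier S.
       sscale S c (splus S x y) = splus S (sscale S c x) (sscale S c y) \<and>
       sscale S c (stimes S x y) = stimes S (sscale S c x) y \<and>
       sscale S c (stimes S x y) = stimes S x (sscale S c y)) \<and>
    (\<forall>c d. \<forall>x\<in>carrier S.
       sscale S (c + d) x = splus S (sscale S c x) (sscale S d x) \<and>
       sscale S (c * d) x = sscale S c (sscale S d x))" (is "_ \<longleftrightarrow> ?A")
  proof
    assume Q: ?Q
    define v where "v x y z = (\<lambda>n::nat. if n = 0 then x else if n = 1 then y else z)" for x y z :: 'a
    have v: "range (v x y z) \<subseteq> carrier S \<longleftrightarrow> x \<in> carrier S \<and> y \<in> carrier S \<and> z \<in> carrier S"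
      for x y z
    proof -
      have "range (v x y z) = {x, y, z}"
        by (auto simp: v_def image_iff intro: exI[of _ "0::nat"] exI[of _ "1::nat"] exI[of _ "2::nat"])
      then show ?thesis by auto
    qed
    have vs: "v x y z 0 = x" "v x y z 1 = y" "v x y z 2 = z" "v x y z (Suc 0) = y" for x y z
      by (auto simp: v_def)
    have *: "\<forall>(s, t)\<in>Reg_ids. eval S (v x y z) s = eval S (v x y z) t"
      if "x \<in> carrier S" "y \<in> carrier S" "z \<in> carrier S" for x y z
      using Q that v by (auto simp del: image_subset_iff)
    have E: "splus S (splus S x y) z = splus S x (splus S y z)"
      "stimes S (stimes S x y) z = stimes S x (stimes S y z)"
      "stimes S (splus S x y) z = splus S (stimes S x z) (stimes S y z)"
      "stimes S z (splus S x y) = splus S (stimes S z x) (stimes S z y)"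
      "splus S x y = splus S y x" "sminus S x y = splus S x (sminus S (szero S) y)"
      "splus S (szero S) x = x" "splus S (sminus S (szero S) x) x = szero S"
      "stimes S (sone S) x = x" "stimes S x (sone S) = x"
      "sscale S 1 x = x" "stimes S (stimes S x (sqinv S x)) x = x"
      "sscale S c (splus S x y) = splus S (sscale S c x) (sscale S c y)"
      "sscale S c (stimes S x y) = stimes S (sscale S c x) y"
      "sscale S c (stimes S x y) = stimes S x (sscale S c y)"
      "sscale S (c + d) x = splus S (sscale S c x) (sscale S d x)"
      "sscale S (c * d) x = sscale S c (sscale S d x)"
      if "x \<in> carrier S" "y \<in> carrier S" "z \<in> carrier S" for x y z c d
      using *[OF that, unfolded Reg_ids_def Let_def, simplified,
          unfolded eval_TPlus eval.simps vs]
      by - blast+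
    show ?A
      by (intro conjI ballI allI) (rule E; assumption)+
  next
    assume ?A
    then show ?Q
      unfolding Reg_ids_def Let_def
      by (auto simp: eval_TPlus image_subset_iff) metis
  qed
  show ?thesis
  proof
    assume S: "S \<in> Reg"
    then have sig: "is_sig_struct S" and ring: "ring (ring_of S)" by (simp_all add: Reg_def)
    interpret ring "ring_of S" by (rule ring)
    have neg: "\<ominus>\<^bsub>ring_of S\<^esub> y = sminus S (szero S) y" if "y \<in> carrier S" for y
    proof -
      have "sminus S (szero S) y = szero S \<ominus>\<^bsub>ring_of S\<^esub> y"
        using S that is_sig_structD(1)[OF sig] by (simp add: Reg_def)
      also have "\<dots> = \<ominus>\<^bsub>ring_of S\<^esub> y"
        using that minus_eq[of "szero S" y] l_zero[of "\<ominus>\<^bsub>ring_of S\<^esub> y"] a_inv_closed[of y]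
        by (simp add: ring_of_simps)
      finally show ?thesis by simp
    qed
    have ?A
      using S a_assoc a_comm l_zero l_neg m_assoc l_one r_one l_distr r_distr neg
      unfolding Reg_def by (auto simp: ring_of_simps a_minus_def) metis
    then show "is_sig_struct S \<and> ?Q" using sig Q by blast
  next
    assume *: "is_sig_struct S \<and> ?Q"
    then have sig: "is_sig_struct S" and A: ?A using Q by blast+
    have pcl: "splus S x y \<in> carrier S" if "x \<in> carrier S" "y \<in> carrier S" for x y
      using that is_sig_structD[OF sig] by (simp add: splus_def)
    note cl = is_sig_structD[OF sig]
    have ax: "splus S (splus S x y) z = splus S x (splus S y z)"
      "stimes S (stimes S x y) z = stimes S x (stimes S y z)"
      "stimes S (splus S x y) z = splus S (stimes S x z) (stimes S y z)"
      "stimes S z (splus S x y) = splus S (stimes S z x) (stimes S z y)"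
      "splus S x y = splus S y x"
      if "x \<in> carrier S" "y \<in> carrier S" "z \<in> carrier S" for x y z
      using A that by blast+
    have ax1: "splus S (szero S) x = x" "splus S (sminus S (szero S) x) x = szero S"
      "stimes S (sone S) x = x" "stimes S x (sone S) = x"
      if "x \<in> carrier S" for x
      using A that by blast+
    have ring: "ring (ring_of S)"
    proof (rule ringI)
      show "abelian_group (ring_of S)"
        by (rule abelian_groupI; unfold ring_of_simps)
          (use cl(1,3) ax1(2) in \<open>blast intro: pcl cl(1) ax(1,5) ax1(1)\<close>)+
      show "monoid (ring_of S)"
        by (rule monoidI; unfold ring_of_simps) (blast intro: cl(2,4) ax(2) ax1(3,4))+
    qed (unfold ring_of_simps, (blast intro: ax(3,4))+)
    interpret ring "ring_of S" by (rule ring)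
    have neg: "\<ominus>\<^bsub>ring_of S\<^esub> y = sminus S (szero S) y" if "y \<in> carrier S" for y
      by (rule minus_equality; unfold ring_of_simps) (blast intro: that cl(1,3) ax1(2))+
    have m: "sminus S x y = x \<ominus>\<^bsub>ring_of S\<^esub> y" if "x \<in> carrier S" "y \<in> carrier S" for x y
      unfolding a_minus_def neg[OF that(2)] ring_of_simps using A that by blast
    show "S \<in> Reg"
      unfolding Reg_def mem_Collect_eq ring_of_simps(2,5)
      by (intro conjI sig ring ballI m) (use A in blast)+
  qed
qed

lemma Mod_subset_Reg:
  fixes E :: "('f::field, nat) tm rel"
  assumes "qinv_variety E"
  shows "(Mod E :: ('a, 'f) sig_struct set) \<subseteq> Reg"
proof
  fix S :: "('a, 'f) sig_struct" assume S: "S \<in> Mod E"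
  let ?P = "presented E (UNIV :: nat set) {}"
  have "?P \<in> Reg"
    using assms presented_in_Mod unfolding qinv_variety_def by blast
  have "eval S v s = eval S v t" if "(s, t) \<in> Reg_ids" "range v \<subseteq> carrier S" for s t v
  proof -
    let ?w = "\<lambda>n. pres_rel E UNIV {} `` {Var n}"
    have "range ?w \<subseteq> carrier ?P"
      by (auto simp: presented_consts quotient_def terms_over_def)
    then have "eval ?P ?w s = eval ?P ?w t"
      using \<open>?P \<in> Reg\<close> that(1) unfolding Reg_iff by blast
    moreover have "subst Var u = u" for u :: "('f, nat) tm" by (induction u) auto
    ultimately have "pres_rel E UNIV {} `` {s} = pres_rel E UNIV {} `` {t}"
      using eval_presented[of s Var UNIV E "{}"] eval_presented[of t Var UNIV E "{}"]
      by (simp add: terms_over_def)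
    then have "pres_cong E UNIV {} s t"
      by (subst (asm) pres_class_eq) (auto simp: terms_over_def)
    then show ?thesis
      by (rule pres_cong_sound[OF S, rotated 2]) (use that(2) in auto)
  qed
  then show "S \<in> Reg" using S unfolding Reg_iff by (auto simp: Mod_def)
qed


subsection \<open>The lattice of principal right ideals\<close>

lemma Reg_regular_ring: "S \<in> Reg \<Longrightarrow> regular_ring (ring_of S)"
  by (auto simp: Reg_def regular_ring_def ring_of_simps is_sig_struct_def)

lemma ideal_lattice_simps:
  "carrier (ideal_lattice R) = right_ideal R ` carrier R"
  "(.=\<^bsub>ideal_lattice R\<^esub>) = (=)" "(\<sqsubseteq>\<^bsub>ideal_lattice R\<^esub>) = (\<subseteq>)"
  by (simp_all add: ideal_lattice_def)

lemma regular_imp_idempotent: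
  assumes "regular_ring R" "x \<in> carrier R"
  obtains e where "e \<in> idempotents R" "right_ideal R e = right_ideal R x"
proof -
  interpret ring R using assms by (simp add: regular_ring_def)
  obtain y where y: "y \<in> carrier R" "x \<otimes>\<^bsub>R\<^esub> y \<otimes>\<^bsub>R\<^esub> x = x"
    using assms by (auto simp: regular_ring_def)
  let ?e = "x \<otimes>\<^bsub>R\<^esub> y"
  have 1: "?e \<in> idempotents R"
    using y assms(2) by (simp add: idempotents_def m_assoc[symmetric])
  have "?e \<otimes>\<^bsub>R\<^esub> r = x \<otimes>\<^bsub>R\<^esub> (y \<otimes>\<^bsub>R\<^esub> r)" "x \<otimes>\<^bsub>R\<^esub> r = ?e \<otimes>\<^bsub>R\<^esub> (x \<otimes>\<^bsub>R\<^esub> r)"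
    if "r \<in> carrier R" for r
    using y assms(2) that by (simp_all add: m_assoc[symmetric])
  then have "right_ideal R ?e = right_ideal R x"
    using y(1) assms(2) unfolding right_ideal_def by blast
  with 1 show ?thesis using that by blast
qed

lemma lattice_leastI:
  assumes "J \<in> right_ideal R ` carrier R" "X \<subseteq> J" "Y \<subseteq> J"
    and "\<And>Z. Z \<in> right_ideal R ` carrier R \<Longrightarrow> X \<subseteq> Z \<Longrightarrow> Y \<subseteq> Z \<Longrightarrow> J \<subseteq> Z"
    and "X \<in> carrier (ideal_lattice R)" "Y \<in> carrier (ideal_lattice R)"
  shows "least (ideal_lattice R) J (Upper (ideal_lattice R) {X, Y})"
  using assms unfolding least_def Upper_def ideal_lattice_simps by auto

lemma lattice_greatestI:
  assumes "J \<in> right_ideal R ` carrier R" "J \<subseteq> X" "J \<subseteq> Y"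
    and "\<And>Z. Z \<in> right_ideal R ` carrier R \<Longrightarrow> Z \<subseteq> X \<Longrightarrow> Z \<subseteq> Y \<Longrightarrow> Z \<subseteq> J"
    and "X \<in> carrier (ideal_lattice R)" "Y \<in> carrier (ideal_lattice R)"
  shows "greatest (ideal_lattice R) J (Lower (ideal_lattice R) {X, Y})"
  using assms unfolding greatest_def Lower_def ideal_lattice_simps by auto

lemma ideal_lattice_bounded_lattice:
  assumes "regular_ring R"
  shows "bounded_lattice (ideal_lattice R)"
proof -
  interpret ring R using assms by (simp add: regular_ring_def)
  note [simp] = ideal_lattice_simps
  have sub: "right_ideal R a \<subseteq> right_ideal R b \<longleftrightarrow> a \<in> right_ideal R b"
    if "a \<in> carrier R" "b \<in> carrier R" for a b
  proof
    assume "right_ideal R a \<subseteq> right_ideal R b"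
    moreover have "a = a \<otimes>\<^bsub>R\<^esub> \<one>\<^bsub>R\<^esub>" using that by simp
    ultimately show "a \<in> right_ideal R b" unfolding right_ideal_def using one_closed by blast
  next
    assume "a \<in> right_ideal R b"
    then obtain r where r: "r \<in> carrier R" "a = b \<otimes>\<^bsub>R\<^esub> r" by (auto simp: right_ideal_def)
    show "right_ideal R a \<subseteq> right_ideal R b"
      using that r unfolding right_ideal_def by (auto simp: m_assoc)
  qed
  have ideal: "a \<oplus>\<^bsub>R\<^esub> b \<in> right_ideal R x" "\<ominus>\<^bsub>R\<^esub> a \<in> right_ideal R x" "a \<otimes>\<^bsub>R\<^esub> r \<in> right_ideal R x"
    if ab: "a \<in> right_ideal R x" "b \<in> right_ideal R x" and "x \<in> carrier R" "r \<in> carrier R" for a b x r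
  proof -
    obtain s t where st: "s \<in> carrier R" "t \<in> carrier R" "a = x \<otimes>\<^bsub>R\<^esub> s" "b = x \<otimes>\<^bsub>R\<^esub> t"
      using ab by (auto simp: right_ideal_def)
    have "a \<oplus>\<^bsub>R\<^esub> b = x \<otimes>\<^bsub>R\<^esub> (s \<oplus>\<^bsub>R\<^esub> t)" "\<ominus>\<^bsub>R\<^esub> a = x \<otimes>\<^bsub>R\<^esub> (\<ominus>\<^bsub>R\<^esub> s)"
      "a \<otimes>\<^bsub>R\<^esub> r = x \<otimes>\<^bsub>R\<^esub> (s \<otimes>\<^bsub>R\<^esub> r)"
      using st that by (simp_all add: r_distr r_minus m_assoc)
    then show "a \<oplus>\<^bsub>R\<^esub> b \<in> right_ideal R x" "\<ominus>\<^bsub>R\<^esub> a \<in> right_ideal R x" "a \<otimes>\<^bsub>R\<^esub> r \<in> right_ideal R x"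
      using st that unfolding right_ideal_def by blast+
  qed
  have minus_zero_imp: "b = a" if "a \<ominus>\<^bsub>R\<^esub> b = \<zero>\<^bsub>R\<^esub>" "a \<in> carrier R" "b \<in> carrier R" for a b
    using that by (metis a_minus_def a_assoc l_neg r_zero l_zero a_inv_closed)
  have glb_lub: "(\<exists>m\<in>carrier R. right_ideal R m = right_ideal R x \<inter> right_ideal R y) \<and>
      (\<exists>j\<in>carrier R. right_ideal R x \<subseteq> right_ideal R j \<and> right_ideal R y \<subseteq> right_ideal R j \<and>
        (\<forall>k\<in>carrier R. right_ideal R x \<subseteq> right_ideal R k \<longrightarrow> right_ideal R y \<subseteq> right_ideal R k
           \<longrightarrow> right_ideal R j \<subseteq> right_ideal R k))"
    if x: "x \<in> carrier R" and y: "y \<in> carrier R" for x y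
  proof -
    obtain e where e: "e \<in> idempotents R" and ex: "right_ideal R e = right_ideal R x"
      using regular_imp_idempotent[OF assms x] .
    then have eR: "e \<in> carrier R" and ee: "e \<otimes>\<^bsub>R\<^esub> e = e" by (auto simp: idempotents_def)
    have mem_e: "a \<in> right_ideal R e \<longleftrightarrow> e \<otimes>\<^bsub>R\<^esub> a = a" if "a \<in> carrier R" for a
      using that eR ee unfolding right_ideal_def by (auto simp: m_assoc[symmetric]) metis
    define z where "z = y \<ominus>\<^bsub>R\<^esub> e \<otimes>\<^bsub>R\<^esub> y"
    have zR: "z \<in> carrier R" using y eR by (simp add: z_def)
    have ez: "e \<otimes>\<^bsub>R\<^esub> z = \<zero>\<^bsub>R\<^esub>"
      using y eR ee by (simp add: z_def a_minus_def r_distr r_minus m_assoc[symmetric] r_neg)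
    have yz: "y = e \<otimes>\<^bsub>R\<^esub> y \<oplus>\<^bsub>R\<^esub> z"
      using y eR by (simp add: z_def a_minus_def a_lcomm r_neg)
    obtain w where w: "w \<in> carrier R" "z \<otimes>\<^bsub>R\<^esub> w \<otimes>\<^bsub>R\<^esub> z = z"
      using assms zR by (auto simp: regular_ring_def)
    have "\<exists>m\<in>carrier R. right_ideal R m = right_ideal R x \<inter> right_ideal R y"
    proof -
      define p where "p = \<one>\<^bsub>R\<^esub> \<ominus>\<^bsub>R\<^esub> w \<otimes>\<^bsub>R\<^esub> z"
      have pR: "p \<in> carrier R" using w zR by (simp add: p_def)
      have zp: "z \<otimes>\<^bsub>R\<^esub> p = \<zero>\<^bsub>R\<^esub>"
        using w zR by (simp add: p_def a_minus_def r_distr r_minus m_assoc[symmetric] r_neg)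
      have zr: "z \<otimes>\<^bsub>R\<^esub> r = y \<otimes>\<^bsub>R\<^esub> r \<ominus>\<^bsub>R\<^esub> e \<otimes>\<^bsub>R\<^esub> (y \<otimes>\<^bsub>R\<^esub> r)" if "r \<in> carrier R" for r
        using that y eR by (simp add: z_def a_minus_def l_distr l_minus m_assoc)
      have "right_ideal R (y \<otimes>\<^bsub>R\<^esub> p) = right_ideal R e \<inter> right_ideal R y"
      proof (intro equalityI subsetI)
        fix a assume "a \<in> right_ideal R (y \<otimes>\<^bsub>R\<^esub> p)"
        then obtain r where r: "r \<in> carrier R" "a = y \<otimes>\<^bsub>R\<^esub> (p \<otimes>\<^bsub>R\<^esub> r)"
          using y pR by (auto simp: right_ideal_def m_assoc)
        have "z \<otimes>\<^bsub>R\<^esub> (p \<otimes>\<^bsub>R\<^esub> r) = \<zero>\<^bsub>R\<^esub>" using zp zR pR r by (simp add: m_assoc[symmetric])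
        then have "a \<ominus>\<^bsub>R\<^esub> e \<otimes>\<^bsub>R\<^esub> a = \<zero>\<^bsub>R\<^esub>" using zr[of "p \<otimes>\<^bsub>R\<^esub> r"] r pR by simp
        moreover have aR: "a \<in> carrier R" using r y pR by simp
        ultimately have "e \<otimes>\<^bsub>R\<^esub> a = a" using eR minus_zero_imp by blast
        moreover have "a \<in> right_ideal R y" using r pR by (auto simp: right_ideal_def)
        ultimately show "a \<in> right_ideal R e \<inter> right_ideal R y" using mem_e aR by simp
      next
        fix a assume a: "a \<in> right_ideal R e \<inter> right_ideal R y"
        then obtain r where r: "r \<in> carrier R" "a = y \<otimes>\<^bsub>R\<^esub> r" by (auto simp: right_ideal_def)
        have "e \<otimes>\<^bsub>R\<^esub> a = a" using a mem_e r y by simp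
        then have "z \<otimes>\<^bsub>R\<^esub> r = \<zero>\<^bsub>R\<^esub>" using zr r y by (simp add: a_minus_def r_neg)
        then have "p \<otimes>\<^bsub>R\<^esub> r = r"
          using r w zR by (simp add: p_def a_minus_def l_distr l_minus m_assoc)
        then have "a = y \<otimes>\<^bsub>R\<^esub> p \<otimes>\<^bsub>R\<^esub> r" using r y pR by (simp add: m_assoc)
        then show "a \<in> right_ideal R (y \<otimes>\<^bsub>R\<^esub> p)" using r by (auto simp: right_ideal_def)
      qed
      then show ?thesis using ex y pR by auto
    qed
    moreover have "\<exists>j\<in>carrier R. right_ideal R x \<subseteq> right_ideal R j \<and> right_ideal R y \<subseteq> right_ideal R j \<and>
        (\<forall>k\<in>carrier R. right_ideal R x \<subseteq> right_ideal R k \<longrightarrow> right_ideal R y \<subseteq> right_ideal R k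
           \<longrightarrow> right_ideal R j \<subseteq> right_ideal R k)"
    proof -
      define g where "g = z \<otimes>\<^bsub>R\<^esub> w"
      define h where "h = g \<ominus>\<^bsub>R\<^esub> g \<otimes>\<^bsub>R\<^esub> e"
      define j where "j = e \<oplus>\<^bsub>R\<^esub> h"
      have gR: "g \<in> carrier R" using w zR by (simp add: g_def)
      have hR: "h \<in> carrier R" using gR eR by (simp add: h_def)
      have jR: "j \<in> carrier R" using hR eR by (simp add: j_def)
      have eg: "e \<otimes>\<^bsub>R\<^esub> g = \<zero>\<^bsub>R\<^esub>" using ez eR zR w by (simp add: g_def m_assoc[symmetric])
      have eh: "e \<otimes>\<^bsub>R\<^esub> h = \<zero>\<^bsub>R\<^esub>"
        using eg eR gR by (simp add: h_def a_minus_def r_distr r_minus m_assoc[symmetric])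
      have he: "h \<otimes>\<^bsub>R\<^esub> e = \<zero>\<^bsub>R\<^esub>"
        using ee eR gR by (simp add: h_def a_minus_def l_distr l_minus m_assoc r_neg)
      have hz: "h \<otimes>\<^bsub>R\<^esub> z = z"
        using ez eR gR zR w by (simp add: h_def a_minus_def l_distr l_minus m_assoc g_def[symmetric])
      have jz: "j \<otimes>\<^bsub>R\<^esub> z = z" using hz ez eR hR zR by (simp add: j_def l_distr)
      have je: "j \<otimes>\<^bsub>R\<^esub> e = e" using ee he eR hR by (simp add: j_def l_distr)
      have mem: "j \<otimes>\<^bsub>R\<^esub> r \<in> right_ideal R j" if "r \<in> carrier R" for r
        using that by (auto simp: right_ideal_def)
      have e_in: "e \<in> right_ideal R j" using mem[OF eR] je by simp
      have z_in: "z \<in> right_ideal R j" using mem[OF zR] jz by simp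
      have y_in: "y \<in> right_ideal R j"
        by (subst yz) (rule ideal(1)[OF ideal(3)[OF e_in e_in jR y] z_in jR jR])
      have jk: "j \<in> right_ideal R k"
        if k: "k \<in> carrier R" "right_ideal R x \<subseteq> right_ideal R k" "right_ideal R y \<subseteq> right_ideal R k" for k
      proof -
        have ek: "e \<in> right_ideal R k" using sub[OF eR k(1)] ex k(2) by simp
        have yk: "y \<in> right_ideal R k" using sub[OF y k(1)] k(3) by simp
        note diff = ideal(1)[OF _ ideal(2)[OF _ _ k(1) k(1)] k(1) k(1), folded a_minus_def]
        have ey: "e \<otimes>\<^bsub>R\<^esub> y \<in> right_ideal R k" by (rule ideal(3)[OF ek ek k(1) y])
        have zk: "z \<in> right_ideal R k" unfolding z_def by (rule diff[OF yk ey ey])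
        have gk: "g \<in> right_ideal R k" unfolding g_def by (rule ideal(3)[OF zk zk k(1) w(1)])
        have ge: "g \<otimes>\<^bsub>R\<^esub> e \<in> right_ideal R k" by (rule ideal(3)[OF gk gk k(1) eR])
        have hk: "h \<in> right_ideal R k" unfolding h_def by (rule diff[OF gk ge ge])
        show ?thesis unfolding j_def by (rule ideal(1)[OF ek hk k(1) k(1)])
      qed
      have xj: "right_ideal R x \<subseteq> right_ideal R j" "right_ideal R y \<subseteq> right_ideal R j"
        using sub[OF eR jR] sub[OF y jR] e_in y_in ex by simp_all
      show ?thesis
      proof (intro bexI[OF _ jR] conjI xj ballI impI)
        fix k assume "k \<in> carrier R" "right_ideal R x \<subseteq> right_ideal R k" "right_ideal R y \<subseteq> right_ideal R k"
        then show "right_ideal R j \<subseteq> right_ideal R k" using jk sub[OF jR] by simp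
      qed
    qed
    ultimately show ?thesis by blast
  qed
  show ?thesis
  proof
    show "\<exists>s. least (ideal_lattice R) s (Upper (ideal_lattice R) {X, Y})"
      if XY: "X \<in> carrier (ideal_lattice R)" "Y \<in> carrier (ideal_lattice R)" for X Y
    proof -
      obtain x y where xy: "x \<in> carrier R" "y \<in> carrier R" "X = right_ideal R x" "Y = right_ideal R y"
        using XY unfolding ideal_lattice_simps by (elim imageE)
      obtain j where j: "j \<in> carrier R"
        "X \<subseteq> right_ideal R j \<and> Y \<subseteq> right_ideal R j \<and>
          (\<forall>k\<in>carrier R. X \<subseteq> right_ideal R k \<longrightarrow> Y \<subseteq> right_ideal R k \<longrightarrow>
            right_ideal R j \<subseteq> right_ideal R k)"
        using glb_lub[OF xy(1,2), folded xy(3,4), THEN conjunct2] by (rule bexE)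
      have "right_ideal R j \<in> right_ideal R ` carrier R" using j(1) by (rule imageI)
      then have "least (ideal_lattice R) (right_ideal R j) (Upper (ideal_lattice R) {X, Y})"
      proof (rule lattice_leastI)
        fix Z assume "Z \<in> right_ideal R ` carrier R" "X \<subseteq> Z" "Y \<subseteq> Z"
        then show "right_ideal R j \<subseteq> Z" using j(2) by (elim imageE) simp
      qed (use j(2) XY in simp_all)
      then show ?thesis ..
    qed
    show "\<exists>s. greatest (ideal_lattice R) s (Lower (ideal_lattice R) {X, Y})"
      if XY: "X \<in> carrier (ideal_lattice R)" "Y \<in> carrier (ideal_lattice R)" for X Y
    proof -
      obtain x y where xy: "x \<in> carrier R" "y \<in> carrier R" "X = right_ideal R x" "Y = right_ideal R y"
        using XY unfolding ideal_lattice_simps by (elim imageE)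
      obtain m where m: "m \<in> carrier R" "right_ideal R m = X \<inter> Y"
        using glb_lub[OF xy(1,2), folded xy(3,4), THEN conjunct1] by (rule bexE)
      have "right_ideal R m \<in> right_ideal R ` carrier R" using m(1) by (rule imageI)
      then have "greatest (ideal_lattice R) (right_ideal R m) (Lower (ideal_lattice R) {X, Y})"
        using XY by (intro lattice_greatestI) (simp_all add: m(2))
      then show ?thesis ..
    qed
    have one_mem: "x \<in> right_ideal R \<one>\<^bsub>R\<^esub>" and zero_mem: "\<zero>\<^bsub>R\<^esub> \<in> right_ideal R x"
      if "x \<in> carrier R" for x
      using that l_one[OF that] r_null[OF that] zero_closed
      unfolding right_ideal_def mem_Collect_eq by metis+
    have top: "X \<subseteq> right_ideal R \<one>\<^bsub>R\<^esub>" if "X \<in> right_ideal R ` carrier R" for X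
      using that one_mem by (elim imageE) (simp add: sub)
    have zero: "right_ideal R \<zero>\<^bsub>R\<^esub> \<subseteq> X" if "X \<in> right_ideal R ` carrier R" for X
      using that zero_mem by (elim imageE) (simp add: sub)
    show "\<exists>b. least (ideal_lattice R) b (carrier (ideal_lattice R))"
      using zero by (intro exI[of _ "right_ideal R \<zero>\<^bsub>R\<^esub>"]) (auto simp: least_def)
    show "\<exists>b. greatest (ideal_lattice R) b (carrier (ideal_lattice R))"
      using top by (intro exI[of _ "right_ideal R \<one>\<^bsub>R\<^esub>"]) (auto simp: greatest_def)
  qed auto
qed

end

theory Submission
  imports Defs "HOL-Analysis.Cartesian_Space" "HOL-Library.Countable_Set_Type"
begin

text \<open>
  Suppose that \<open>\<epsilon>\<close> is a Banaschewski function on the generators and write each \<open>\<epsilon>(\<xi>)\<close> as a term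
  whose variables form a finite set \<open>S \<xi>\<close>. Since countable subsets of \<open>\<omega>\<^sub>1\<close> are bounded, there are
  \<open>\<xi> < \<eta>\<close> such that all elements of \<open>S \<xi>\<close> lie below \<open>\<eta>\<close> and no element of \<open>S \<eta>\<close> lies in the
  interval from \<open>\<xi>\<close> to \<open>\<eta>\<close>. Send the generators below \<open>\<xi>\<close> to \<open>0\<close>, those in the interval to \<open>A\<close>, and
  all others to \<open>B\<close>. As \<open>\<bbbF>[A]\<close> and \<open>\<bbbF>[B]\<close> are closed under quasi-inversion, the image of \<open>\<epsilon>(\<xi>)\<close>
  lies in \<open>\<bbbF>[A]\<close> and that of \<open>\<epsilon>(\<eta>)\<close> in \<open>\<bbbF>[B]\<close>; an element of \<open>\<bbbF>[M]\<close> commutes with \<open>M\<close>, so the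
  images are \<open>A\<close> and \<open>B\<close> themselves. Hence \<open>A = AB\<close>, which is false.

  A Banaschewski function on the ideals gives one on the generators: the components in
  \<open>\<xi>R\<close> of \<open>1\<close> along the decompositions \<open>R = \<xi>R \<oplus> f(\<xi>R)\<close>.
\<close>

section \<open>A separation property of finite subsets of \<open>\<omega>\<^sub>1\<close>\<close>

text \<open>The larger point is the supremum \<open>\<delta>\<close> of an increasing sequence
  \<open>\<gamma> n\<close> chosen so that \<open>S (\<gamma> n)\<close> lies below
  \<open>\<gamma> (Suc n)\<close>. The finitely many elements of \<open>S \<delta>\<close> below
  \<open>\<delta>\<close> are all passed by some \<open>\<gamma> N\<close>, which serves as the
  smaller point.\<close>

lemma separated_pair:
  fixes r :: "'i rel" and S :: "'i \<Rightarrow> 'i set"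
  assumes wo: "Well_order r" and ne: "Field r \<noteq> {}"
    and bounded: "\<And>K. countable K \<Longrightarrow> K \<subseteq> Field r \<Longrightarrow> \<exists>a\<in>Field r. \<forall>b\<in>K. (b, a) \<in> r \<and> b \<noteq> a"
    and S: "\<And>\<xi>. \<xi> \<in> Field r \<Longrightarrow> finite (S \<xi>) \<and> S \<xi> \<subseteq> Field r"
  obtains \<xi> \<eta> where "\<xi> \<in> Field r" "\<eta> \<in> Field r" "(\<xi>, \<eta>) \<in> r" "\<xi> \<noteq> \<eta>"
    and "\<And>s. s \<in> S \<xi> \<Longrightarrow> (s, \<eta>) \<in> r \<and> s \<noteq> \<eta>"
    and "\<And>s. s \<in> S \<eta> \<Longrightarrow> (\<xi>, s) \<in> r \<Longrightarrow> (\<eta>, s) \<in> r"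
proof -
  interpret wo_rel r using wo by (simp add: wo_rel_def)
  define lt where "lt a b \<longleftrightarrow> (a, b) \<in> r \<and> a \<noteq> b" for a b
  have lt_trans: "lt a c" if "lt a b" "lt b c" for a b c
    using that TRANS ANTISYM unfolding lt_def trans_def antisym_def by blast
  have le_lt_trans: "lt a c" if "(a, b) \<in> r" "lt b c" for a b c
    using that TRANS ANTISYM unfolding lt_def trans_def antisym_def by blast
  have total: "(a, b) \<in> r \<or> lt b a" if "a \<in> Field r" "b \<in> Field r" for a b
    using that TOTALS unfolding lt_def by blast
  have not_both: "\<not> (lt a b \<and> (b, a) \<in> r)" for a b
    using ANTISYM unfolding lt_def antisym_def by blast
  \<comment> \<open>Bounding \<open>\<xi>\<close> together with \<open>S \<xi>\<close> makes the
    iterates of \<open>g\<close> strictly increasing and at the same time puts each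
    \<open>S (\<gamma> n)\<close> below the next iterate.\<close>
  have "\<exists>a\<in>Field r. \<forall>b\<in>insert \<xi> (S \<xi>). lt b a" if "\<xi> \<in> Field r" for \<xi>
    using bounded[of "insert \<xi> (S \<xi>)"] S[OF that] that
    unfolding lt_def by (simp add: uncountable_infinite countable_finite)
  then obtain g where g: "\<And>\<xi>. \<xi> \<in> Field r \<Longrightarrow> g \<xi> \<in> Field r"
    "\<And>\<xi> b. \<xi> \<in> Field r \<Longrightarrow> b \<in> insert \<xi> (S \<xi>) \<Longrightarrow> lt b (g \<xi>)" by metis
  obtain \<gamma>\<^sub>0 where "\<gamma>\<^sub>0 \<in> Field r" using ne by blast
  define \<gamma> where "\<gamma> n = (g ^^ n) \<gamma>\<^sub>0" for n
  have \<gamma>: "\<gamma> n \<in> Field r" for n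
    by (induction n) (simp_all add: \<gamma>_def \<open>\<gamma>\<^sub>0 \<in> Field r\<close> g(1))
  have step: "lt b (\<gamma> (Suc n))" if "b \<in> insert (\<gamma> n) (S (\<gamma> n))" for b n
    using g(2)[OF \<gamma> that] by (simp add: \<gamma>_def)
  \<comment> \<open>The least strict upper bound of the sequence is its supremum: whatever lies
    strictly below it is already below some \<open>\<gamma> n\<close>.\<close>
  define U where "U = {a \<in> Field r. \<forall>n. lt (\<gamma> n) a}"
  have "U \<noteq> {}"
    using bounded[of "range \<gamma>"] \<gamma> unfolding U_def lt_def by auto
  moreover have "U \<subseteq> Field r" by (auto simp: U_def)
  ultimately obtain \<delta> where \<delta>: "\<delta> \<in> U" "\<And>a. a \<in> U \<Longrightarrow> (\<delta>, a) \<in> r"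
    using minim_in minim_least by metis
  then have \<delta>F: "\<delta> \<in> Field r" and \<gamma>\<delta>: "\<And>n. lt (\<gamma> n) \<delta>" by (auto simp: U_def)
  have mono: "lt (\<gamma> m) (\<gamma> n)" if "m < n" for m n
    using that by (induction rule: less_Suc_induct) (use step lt_trans in blast)+
  have ex: "\<exists>n. lt s (\<gamma> n)" if "lt s \<delta>" for s
  proof -
    have sF: "s \<in> Field r" using that by (auto simp: lt_def Field_def)
    have "s \<notin> U" using \<delta>(2) not_both that by blast
    then obtain n where "\<not> lt (\<gamma> n) s" using sF by (auto simp: U_def)
    then have "(s, \<gamma> n) \<in> r" using total[OF sF \<gamma>] by blast
    then show ?thesis using le_lt_trans step by blast
  qed
  then obtain k where k: "\<And>s. lt s \<delta> \<Longrightarrow> lt s (\<gamma> (k s))" by metis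
  \<comment> \<open>The inserted 0 keeps the maximum defined when \<open>S \<delta>\<close> is
    empty. The successor makes \<open>k s < N\<close> strict, as \<open>mono\<close> requires.
    Values of \<open>k\<close> at points not below \<open>\<delta>\<close> are arbitrary and only
    enlarge \<open>N\<close>.\<close>
  define N where "N = Suc (Max (insert 0 (k ` S \<delta>)))"
  have N: "lt s (\<gamma> N)" if "s \<in> S \<delta>" "lt s \<delta>" for s
  proof -
    have "k s < N"
      using that S[OF \<delta>F] by (simp add: N_def less_Suc_eq_le Max_ge_iff)
    then show ?thesis using k[OF that(2)] mono lt_trans by blast
  qed
  show thesis
  proof (rule that[OF \<gamma>[of N] \<delta>F])
    show "(\<gamma> N, \<delta>) \<in> r" "\<gamma> N \<noteq> \<delta>" using \<gamma>\<delta>[of N] by (auto simp: lt_def)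
    show "(s, \<delta>) \<in> r \<and> s \<noteq> \<delta>" if "s \<in> S (\<gamma> N)" for s
      using step[of s N] that \<gamma>\<delta> lt_trans unfolding lt_def by blast
    show "(\<delta>, s) \<in> r" if "s \<in> S \<delta>" "(\<gamma> N, s) \<in> r" for s
      using total[OF \<delta>F, of s] N[OF that(1)] not_both that S[OF \<delta>F] by blast
  qed
qed

section \<open>Boundedness of countable subsets of \<omega>1\<close>

lemma omega1_Well_order: "Well_order omega1"
  unfolding omega1_def
  by (intro Card_order_wo_rel[unfolded wo_rel_def] cardSuc_Card_order natLeq_Card_order)

lemma infinite_Field_omega1: "infinite (Field omega1)"
  unfolding omega1_def using cardSuc_finite[OF natLeq_Card_order] by (simp add: Field_natLeq)

text \<open>A successor cardinal is regular, so a set of smaller cardinality cannot be cofinal in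
  it.\<close>

lemma omega1_countable_bounded:
  assumes "countable K" "K \<subseteq> Field omega1"
  shows "\<exists>a\<in>Field omega1. \<forall>b\<in>K. (b, a) \<in> omega1 \<and> b \<noteq> a"
proof -
  interpret wo_rel omega1 using omega1_Well_order by (simp add: wo_rel_def)
  have reg: "regularCard omega1"
    unfolding omega1_def by (rule regularCard_cardSuc[OF natLeq_Cinfinite])
  have "(card_of K, omega1) \<in> ordLess"
    using assms(1) unfolding omega1_def countable_card_le_natLeq
    by (rule ordLeq_ordLess_trans) (rule cardSuc_greater[OF natLeq_Card_order])
  then have "\<not> cofinal K omega1"
    using reg assms(2) not_ordLess_ordIso unfolding regularCard_def by blast
  \<comment> \<open>Failure of cofinality yields a point with no element of \<open>K\<close>
    strictly above it; by totality \<open>K\<close> then lies weakly below \<open>a\<close>.\<close>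
  then obtain a where a: "a \<in> Field omega1" "\<And>b. b \<in> K \<Longrightarrow> a = b \<or> (a, b) \<notin> omega1"
    unfolding cofinal_def by blast
  have le: "(b, a) \<in> omega1" if "b \<in> K" for b
    using a(2)[OF that] TOTALS a(1) assms(2) that by blast
  \<comment> \<open>The point \<open>a\<close> may itself belong to \<open>K\<close>. An infinite
    cardinal has no last element, so a larger \<open>c\<close> turns the weak bound into a strict
    one.\<close>
  obtain c where c: "c \<in> Field omega1" "a \<noteq> c" "(a, c) \<in> omega1"
    using infinite_Card_order_limit[OF cardSuc_Card_order[OF natLeq_Card_order], folded omega1_def]
      infinite_Field_omega1 a(1) by blast
  show ?thesis
    using c le TRANS ANTISYM unfolding trans_def antisym_def by blast
qed

section \<open>The algebras \<open>\<bbbF>[A]\<close> and \<open>\<bbbF>[B]\<close>\<close>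

lemma gen_subalgebra_unital: "unital_subalgebra (gen_subalgebra M)"
  unfolding unital_subalgebra_def gen_subalgebra_def by blast

lemma gen_subalgebra_generator: "M \<in> gen_subalgebra M"
  unfolding gen_subalgebra_def by blast

lemma mscale_mult:
  fixes X Y :: "'f::field^3^3"
  shows "mscale c X ** Y = mscale c (X ** Y)" and "X ** mscale c Y = mscale c (X ** Y)"
  by (simp_all add: mscale_def map_matrix_def matrix_matrix_mult_def vec_eq_iff
      sum_distrib_left mult.assoc mult.left_commute)

text \<open>The centralizer of \<open>M\<close> is a unital subalgebra containing \<open>M\<close>,
  hence contains the one generated by \<open>M\<close>.\<close>

lemma gen_subalgebra_commute:
  fixes X M :: "'f::field^3^3"
  assumes "X \<in> gen_subalgebra M"
  shows "X ** M = M ** X"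
proof -
  have rdistrib: "(X + Y) ** Z = X ** Z + Y ** Z" for X Y Z :: "'f^3^3"
    by (simp add: matrix_matrix_mult_def vec_eq_iff sum.distrib distrib_right)
  have "unital_subalgebra {X. X ** M = M ** X}"
    unfolding unital_subalgebra_def
    by (auto simp: mscale_mult matrix_add_ldistrib rdistrib) (metis matrix_mul_assoc)
  then show ?thesis using assms unfolding gen_subalgebra_def by blast
qed

lemma unital_subalgebra_closed:
  assumes "unital_subalgebra T"
  shows "0 \<in> T" and "X \<in> T \<Longrightarrow> Y \<in> T \<Longrightarrow> X - Y \<in> T"
proof -
  have "mscale 0 (mat 1) \<in> T" using assms by (simp add: unital_subalgebra_def)
  moreover have "mscale 0 (mat 1) = (0 :: 'a^3^3)"
    by (simp add: mscale_def map_matrix_def vec_eq_iff)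
  ultimately show "0 \<in> T" by simp
  assume "X \<in> T" "Y \<in> T"
  then have "X + mscale (-1) Y \<in> T" using assms by (simp add: unital_subalgebra_def)
  moreover have "X + mscale (-1) Y = X - Y"
    by (simp add: mscale_def map_matrix_def vec_eq_iff)
  ultimately show "X - Y \<in> T" by simp
qed

text \<open>Both algebras are among the four candidates in the choice of the quasi-inversion. The
  least candidate containing \<open>X\<close> is therefore contained in each of them that contains
  \<open>X\<close>, so each is closed under \<open>q\<close> as well as under the algebra
  operations.\<close>

lemma RF_eval_gen_subalgebra:
  assumes q: "RF_quasi_inversion q" and M: "M = matA \<or> M = matB"
    and v: "\<And>x. x \<in> vars t \<Longrightarrow> v x \<in> gen_subalgebra M"
  shows "eval (RF q) v t \<in> gen_subalgebra M"
proof -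
  have qinv: "q X \<in> gen_subalgebra M" if "X \<in> gen_subalgebra M" for X
    using q M that unfolding RF_quasi_inversion_def Let_def by blast
  note u = gen_subalgebra_unital[of M]
  show ?thesis
    using v
    by (induction t)
      (use u in \<open>auto simp: RF_def qinv unital_subalgebra_closed[OF u] unital_subalgebra_def\<close>)
qed

text \<open>The first three equations make the matrix assignment compatible with the chain
  relations. The last says that the ideal inclusion given by BA = A does not lift to the order on
  idempotents.\<close>

lemma matA_matB:
  "matA ** matA = (matA :: 'f::field^3^3)" "matB ** matB = (matB :: 'f::field^3^3)"
  "matB ** matA = (matA :: 'f::field^3^3)" "matA ** matB \<noteq> (matA :: 'f::field^3^3)"
  by (auto simp: matA_def matB_def matrix_matrix_mult_def vec_eq_iff sum_3 forall_3)

section \<open>Banaschewski functions on rings and on lattices of ideals\<close>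

lemma mem_right_ideal_idempotent:
  assumes "ring R" "e \<in> idempotents R" "x \<in> right_ideal R e"
  shows "e \<otimes>\<^bsub>R\<^esub> x = x"
proof -
  interpret ring R by fact
  show ?thesis using assms(2,3) by (auto simp: idempotents_def right_ideal_def m_assoc[symmetric])
qed

lemma right_ideal_self:
  assumes "ring R" "x \<in> carrier R"
  shows "x \<in> right_ideal R x"
proof -
  interpret ring R by fact
  show ?thesis
    using assms(2) r_one[OF assms(2)] unfolding right_ideal_def
    by (metis (mono_tags, lifting) mem_Collect_eq one_closed)
qed

lemma right_ideal_subset_iff:
  assumes "ring R" "x \<in> carrier R" "y \<in> carrier R"
  shows "right_ideal R x \<subseteq> right_ideal R y \<longleftrightarrow> x \<in> right_ideal R y"
proof
  interpret ring R by fact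
  show "x \<in> right_ideal R y" if "right_ideal R x \<subseteq> right_ideal R y"
    using that right_ideal_self[OF assms(1,2)] by blast
  show "right_ideal R x \<subseteq> right_ideal R y" if "x \<in> right_ideal R y"
    using that assms(2,3) by (auto simp: right_ideal_def m_assoc)
qed

text \<open>In a regular ring the sum of two principal right ideals is principal. The explicit form
  of \<open>j\<close> later allows 1 to be split into a part from each ideal.\<close>

lemma right_ideal_sum:
  assumes "regular_ring R" and x: "x \<in> carrier R" and y: "y \<in> carrier R"
  obtains j a b where "j \<in> carrier R" "x \<in> right_ideal R j" "y \<in> right_ideal R j"
    and "a \<in> carrier R" "b \<in> carrier R" "j = x \<otimes>\<^bsub>R\<^esub> a \<oplus>\<^bsub>R\<^esub> y \<otimes>\<^bsub>R\<^esub> b"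
proof -
  interpret ring R using assms by (simp add: regular_ring_def)
  obtain u where u: "u \<in> carrier R" "x \<otimes>\<^bsub>R\<^esub> u \<otimes>\<^bsub>R\<^esub> x = x"
    using assms by (auto simp: regular_ring_def)
  define e where "e = x \<otimes>\<^bsub>R\<^esub> u"
  define f where "f = \<one>\<^bsub>R\<^esub> \<ominus>\<^bsub>R\<^esub> e"
  have eR: "e \<in> carrier R" and ex: "e \<otimes>\<^bsub>R\<^esub> x = x" using u x by (simp_all add: e_def)
  have fR: "f \<in> carrier R" using eR by (simp add: f_def)
  have fx: "f \<otimes>\<^bsub>R\<^esub> x = \<zero>\<^bsub>R\<^esub>"
    using ex eR x by (simp add: f_def a_minus_def l_distr l_minus r_neg)
  obtain w where w: "w \<in> carrier R" "f \<otimes>\<^bsub>R\<^esub> y \<otimes>\<^bsub>R\<^esub> w \<otimes>\<^bsub>R\<^esub> (f \<otimes>\<^bsub>R\<^esub> y) = f \<otimes>\<^bsub>R\<^esub> y"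
    using assms fR by (auto simp: regular_ring_def)
  \<comment> \<open>The right factor \<open>f\<close> kills \<open>x\<close>, and the choice of
    \<open>w\<close> gives \<open>h\<close> the same effect on \<open>y\<close> as \<open>f\<close>.
    Hence \<open>e\<close> plus \<open>h\<close> fixes both \<open>x\<close> and \<open>y\<close>
    from the left.\<close>
  define h where "h = f \<otimes>\<^bsub>R\<^esub> y \<otimes>\<^bsub>R\<^esub> w \<otimes>\<^bsub>R\<^esub> f"
  define j where "j = e \<oplus>\<^bsub>R\<^esub> h"
  have hR: "h \<in> carrier R" using fR y w by (simp add: h_def)
  have jR: "j \<in> carrier R" using eR hR by (simp add: j_def)
  have hx: "h \<otimes>\<^bsub>R\<^esub> x = \<zero>\<^bsub>R\<^esub>" using fx fR y w x by (simp add: h_def m_assoc)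
  have hy: "h \<otimes>\<^bsub>R\<^esub> y = f \<otimes>\<^bsub>R\<^esub> y" using w fR y by (simp add: h_def m_assoc)
  have jx: "x = j \<otimes>\<^bsub>R\<^esub> x" using hx ex eR hR x by (simp add: j_def l_distr)
  have "j \<otimes>\<^bsub>R\<^esub> y = (e \<oplus>\<^bsub>R\<^esub> f) \<otimes>\<^bsub>R\<^esub> y" using hy eR fR hR y by (simp add: j_def l_distr)
  also have "e \<oplus>\<^bsub>R\<^esub> f = \<one>\<^bsub>R\<^esub>" using eR by (simp add: f_def a_minus_def a_lcomm[of e] r_neg)
  finally have jy: "y = j \<otimes>\<^bsub>R\<^esub> y" using y by simp
  \<comment> \<open>Writing the leading \<open>f\<close> as 1 - xu exhibits \<open>h\<close>, and
    then \<open>j\<close>, as an element of xR + yR.\<close>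
  have "h = y \<otimes>\<^bsub>R\<^esub> (w \<otimes>\<^bsub>R\<^esub> f) \<ominus>\<^bsub>R\<^esub> x \<otimes>\<^bsub>R\<^esub> (u \<otimes>\<^bsub>R\<^esub> y \<otimes>\<^bsub>R\<^esub> w \<otimes>\<^bsub>R\<^esub> f)"
    unfolding h_def using u(1) x y w(1) fR eR
    by (subst f_def) (simp add: a_minus_def l_distr l_minus m_assoc e_def)
  then have "j = x \<otimes>\<^bsub>R\<^esub> (u \<ominus>\<^bsub>R\<^esub> u \<otimes>\<^bsub>R\<^esub> y \<otimes>\<^bsub>R\<^esub> w \<otimes>\<^bsub>R\<^esub> f) \<oplus>\<^bsub>R\<^esub> y \<otimes>\<^bsub>R\<^esub> (w \<otimes>\<^bsub>R\<^esub> f)"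
    unfolding j_def using u(1) x y w(1) fR
    by (simp add: e_def a_minus_def r_distr r_minus a_ac)
  moreover have "u \<ominus>\<^bsub>R\<^esub> u \<otimes>\<^bsub>R\<^esub> y \<otimes>\<^bsub>R\<^esub> w \<otimes>\<^bsub>R\<^esub> f \<in> carrier R" "w \<otimes>\<^bsub>R\<^esub> f \<in> carrier R"
    using u(1) y w(1) fR by simp_all
  moreover have "x \<in> right_ideal R j" "y \<in> right_ideal R j"
    using jx jy x y unfolding right_ideal_def by blast+
  ultimately show thesis using that jR by blast
qed

text \<open>Complements in the ideal lattice give a direct decomposition of the ring;
  \<open>e\<close> is the component of 1 in xR, and left multiplication by it projects onto xR along
  yR.\<close>

lemma complement_idempotent:
  assumes reg: "regular_ring R" and x: "x \<in> carrier R" and y: "y \<in> carrier R"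
    and meet: "right_ideal R x \<sqinter>\<^bsub>ideal_lattice R\<^esub> right_ideal R y = \<bottom>\<^bsub>ideal_lattice R\<^esub>"
    and join: "right_ideal R x \<squnion>\<^bsub>ideal_lattice R\<^esub> right_ideal R y = \<top>\<^bsub>ideal_lattice R\<^esub>"
  shows "\<exists>e\<in>right_ideal R x. \<one>\<^bsub>R\<^esub> \<ominus>\<^bsub>R\<^esub> e \<in> right_ideal R y \<and>
    (\<forall>z\<in>right_ideal R x. e \<otimes>\<^bsub>R\<^esub> z = z) \<and> (\<forall>z\<in>right_ideal R y. e \<otimes>\<^bsub>R\<^esub> z = \<zero>\<^bsub>R\<^esub>)"
proof -
  interpret R: ring R using reg by (simp add: regular_ring_def)
  interpret L: bounded_lattice "ideal_lattice R" using reg by (rule ideal_lattice_bounded_lattice)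
  let ?I = "right_ideal R"
  have car: "?I z \<in> carrier (ideal_lattice R)" if "z \<in> carrier R" for z
    using that by (simp add: ideal_lattice_simps)
  have le: "?I z \<sqsubseteq>\<^bsub>ideal_lattice R\<^esub> ?I z' \<longleftrightarrow> z \<in> ?I z'" if "z \<in> carrier R" "z' \<in> carrier R" for z z'
    using right_ideal_subset_iff[OF R.ring_axioms that] by (simp add: ideal_lattice_simps)
  \<comment> \<open>A common element generates a principal ideal below the meet, hence below the
    zero ideal; the order-theoretic meet thus yields a trivial intersection.\<close>
  have disj: "z = \<zero>\<^bsub>R\<^esub>" if "z \<in> ?I x" "z \<in> ?I y" for z
  proof -
    have zR: "z \<in> carrier R" using that x by (auto simp: right_ideal_def)
    have "?I z \<sqsubseteq>\<^bsub>ideal_lattice R\<^esub> ?I x \<sqinter>\<^bsub>ideal_lattice R\<^esub> ?I y"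
      using that zR x y by (intro L.meet_le) (simp_all add: car le)
    also have "\<dots> \<sqsubseteq>\<^bsub>ideal_lattice R\<^esub> ?I \<zero>\<^bsub>R\<^esub>"
      unfolding meet by (rule L.bottom_lower) (simp add: car)
    finally have "z \<in> ?I \<zero>\<^bsub>R\<^esub>" using zR by (simp add: le car x y)
    then show ?thesis by (auto simp: right_ideal_def)
  qed
  obtain j a b where j: "j \<in> carrier R" "x \<in> ?I j" "y \<in> ?I j"
    "a \<in> carrier R" "b \<in> carrier R" "j = x \<otimes>\<^bsub>R\<^esub> a \<oplus>\<^bsub>R\<^esub> y \<otimes>\<^bsub>R\<^esub> b"
    using right_ideal_sum[OF reg x y] by metis
  \<comment> \<open>Since \<open>j\<close> generates an upper bound of both ideals, the ideal of
    \<open>j\<close> contains their join, which is the top; so 1 is a right multiple of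
    \<open>j\<close>.\<close>
  have "?I \<one>\<^bsub>R\<^esub> \<sqsubseteq>\<^bsub>ideal_lattice R\<^esub> ?I x \<squnion>\<^bsub>ideal_lattice R\<^esub> ?I y"
    unfolding join by (rule L.top_higher) (simp add: car)
  also have "\<dots> \<sqsubseteq>\<^bsub>ideal_lattice R\<^esub> ?I j"
    using j x y by (intro L.join_le) (simp_all add: car le)
  finally have "\<one>\<^bsub>R\<^esub> \<in> ?I j" using j(1) by (simp add: le car x y)
  then obtain r where r: "r \<in> carrier R" "\<one>\<^bsub>R\<^esub> = j \<otimes>\<^bsub>R\<^esub> r" by (auto simp: right_ideal_def)
  define e where "e = x \<otimes>\<^bsub>R\<^esub> (a \<otimes>\<^bsub>R\<^esub> r)"
  define e' where "e' = y \<otimes>\<^bsub>R\<^esub> (b \<otimes>\<^bsub>R\<^esub> r)"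
  have eR: "e \<in> carrier R" "e' \<in> carrier R" using x y j r by (simp_all add: e_def e'_def)
  have one: "e \<oplus>\<^bsub>R\<^esub> e' = \<one>\<^bsub>R\<^esub>"
    using j(4-6) r x y by (simp add: e_def e'_def R.l_distr R.m_assoc)
  have split: "e \<otimes>\<^bsub>R\<^esub> z \<oplus>\<^bsub>R\<^esub> e' \<otimes>\<^bsub>R\<^esub> z = z" if "z \<in> carrier R" for z
    using one that eR by (simp add: R.l_distr[symmetric])
  have e'_eq: "\<one>\<^bsub>R\<^esub> \<ominus>\<^bsub>R\<^esub> e = e'"
    unfolding one[symmetric] using eR by (simp add: a_minus_def R.a_ac R.r_neg)
  have mul: "z \<otimes>\<^bsub>R\<^esub> s \<in> ?I t" if "z \<in> ?I t" "s \<in> carrier R" "t \<in> carrier R" for z s t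
    using that by (auto simp: right_ideal_def R.m_assoc)
  have diff: "z \<ominus>\<^bsub>R\<^esub> z' \<in> ?I t" if "z \<in> ?I t" "z' \<in> ?I t" "t \<in> carrier R" for z z' t
  proof -
    obtain s s' where "s \<in> carrier R" "s' \<in> carrier R" "z = t \<otimes>\<^bsub>R\<^esub> s" "z' = t \<otimes>\<^bsub>R\<^esub> s'"
      using \<open>z \<in> ?I t\<close> \<open>z' \<in> ?I t\<close> by (auto simp: right_ideal_def)
    then have "z \<ominus>\<^bsub>R\<^esub> z' = t \<otimes>\<^bsub>R\<^esub> (s \<ominus>\<^bsub>R\<^esub> s')" "s \<ominus>\<^bsub>R\<^esub> s' \<in> carrier R"
      using that(3) by (simp_all add: a_minus_def R.r_distr R.r_minus)
    then show ?thesis unfolding right_ideal_def by blast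
  qed
  have sub: "z \<in> carrier R" if "z \<in> ?I t" "t \<in> carrier R" for z t
    using that by (auto simp: right_ideal_def)
  have eI: "e \<in> ?I x" "e' \<in> ?I y" using j r unfolding e_def e'_def right_ideal_def by blast+
  have ez: "e \<otimes>\<^bsub>R\<^esub> z = z" if z: "z \<in> ?I x" for z
  proof -
    have zR: "z \<in> carrier R" using sub z x by blast
    \<comment> \<open>The difference lies in xR by its left side and in yR by its right side, so it
      vanishes.\<close>
    have "z \<ominus>\<^bsub>R\<^esub> e \<otimes>\<^bsub>R\<^esub> z = e' \<otimes>\<^bsub>R\<^esub> z"
      by (subst split[OF zR, symmetric]) (use eR zR in \<open>simp add: a_minus_def R.a_ac R.r_neg\<close>)
    moreover have "z \<ominus>\<^bsub>R\<^esub> e \<otimes>\<^bsub>R\<^esub> z \<in> ?I x" by (intro diff mul eI z zR x)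
    ultimately have "e' \<otimes>\<^bsub>R\<^esub> z = \<zero>\<^bsub>R\<^esub>" using disj mul[OF eI(2) zR y] by metis
    then show ?thesis using split[OF zR] eR zR by simp
  qed
  have ez': "e \<otimes>\<^bsub>R\<^esub> z = \<zero>\<^bsub>R\<^esub>" if z: "z \<in> ?I y" for z
  proof -
    have zR: "z \<in> carrier R" using sub z y by blast
    have "z \<ominus>\<^bsub>R\<^esub> e' \<otimes>\<^bsub>R\<^esub> z = e \<otimes>\<^bsub>R\<^esub> z"
      by (subst split[OF zR, symmetric]) (use eR zR in \<open>simp add: a_minus_def R.a_assoc R.r_neg\<close>)
    moreover have "z \<ominus>\<^bsub>R\<^esub> e' \<otimes>\<^bsub>R\<^esub> z \<in> ?I y" by (intro diff mul eI z zR y)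
    ultimately show ?thesis using disj mul[OF eI(1) zR x] by metis
  qed
  show ?thesis using eI e'_eq ez ez' by blast
qed

text \<open>The value at \<open>x\<close> is the projection onto xR along the complement chosen by
  \<open>f\<close>. Antitonicity of \<open>f\<close> is what makes these projections
  comparable.\<close>

lemma lattice_imp_ring_Banaschewski:
  assumes reg: "regular_ring R" and X: "X \<subseteq> carrier R"
    and f: "lattice_partial_Banaschewski (ideal_lattice R) (right_ideal R ` X) f"
  shows "\<exists>\<epsilon>. ring_partial_Banaschewski R X \<epsilon>"
proof -
  interpret ring R using reg by (simp add: regular_ring_def)
  let ?I = "right_ideal R"
  note f' = f[unfolded lattice_partial_Banaschewski_def ideal_lattice_simps, THEN conjunct1]
    f[unfolded lattice_partial_Banaschewski_def ideal_lattice_simps, THEN conjunct2, THEN conjunct1]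
    f[unfolded lattice_partial_Banaschewski_def ideal_lattice_simps, THEN conjunct2, THEN conjunct2]
  have "\<exists>e\<in>?I x. \<one>\<^bsub>R\<^esub> \<ominus>\<^bsub>R\<^esub> e \<in> f (?I x) \<and>
    (\<forall>z\<in>?I x. e \<otimes>\<^bsub>R\<^esub> z = z) \<and> (\<forall>z\<in>f (?I x). e \<otimes>\<^bsub>R\<^esub> z = \<zero>\<^bsub>R\<^esub>)" if "x \<in> X" for x
  proof -
    have mem: "?I x \<in> ?I ` X" using that by (rule imageI)
    note fx = f'(1)[THEN bspec, OF mem]
      f'(3)[THEN bspec, OF mem, THEN conjunct1] f'(3)[THEN bspec, OF mem, THEN conjunct2]
    from fx(1) obtain y where y: "y \<in> carrier R" "f (?I x) = ?I y" by (rule imageE)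
    show ?thesis
      unfolding y(2)
      by (rule complement_idempotent[OF reg _ y(1) fx(2,3)[unfolded y(2)]]) (use that X in blast)
  qed
  then have "\<forall>x\<in>X. \<exists>e. e \<in> ?I x \<and> \<one>\<^bsub>R\<^esub> \<ominus>\<^bsub>R\<^esub> e \<in> f (?I x) \<and>
    (\<forall>z\<in>?I x. e \<otimes>\<^bsub>R\<^esub> z = z) \<and> (\<forall>z\<in>f (?I x). e \<otimes>\<^bsub>R\<^esub> z = \<zero>\<^bsub>R\<^esub>)"
    by (intro ballI) (simp only: Bex_def)
  from bchoice[OF this] obtain \<epsilon> where
    \<epsilon>: "\<And>x. x \<in> X \<Longrightarrow> \<epsilon> x \<in> ?I x"
    "\<And>x. x \<in> X \<Longrightarrow> \<one>\<^bsub>R\<^esub> \<ominus>\<^bsub>R\<^esub> \<epsilon> x \<in> f (?I x)"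
    "\<And>x z. x \<in> X \<Longrightarrow> z \<in> ?I x \<Longrightarrow> \<epsilon> x \<otimes>\<^bsub>R\<^esub> z = z"
    "\<And>x z. x \<in> X \<Longrightarrow> z \<in> f (?I x) \<Longrightarrow> \<epsilon> x \<otimes>\<^bsub>R\<^esub> z = \<zero>\<^bsub>R\<^esub>" by blast
  have \<epsilon>R: "\<epsilon> x \<in> carrier R" if "x \<in> X" for x
    using \<epsilon>(1)[OF that] that X by (auto simp: right_ideal_def)
  have "ring_partial_Banaschewski R X \<epsilon>"
    unfolding ring_partial_Banaschewski_def
  proof (intro conjI ballI impI)
    fix x assume x: "x \<in> X"
    then have xR: "x \<in> carrier R" using X by blast
    show "\<epsilon> x \<in> idempotents R" using \<epsilon>(1,3)[OF x] \<epsilon>R[OF x] by (simp add: idempotents_def)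
    have "x = \<epsilon> x \<otimes>\<^bsub>R\<^esub> x" using \<epsilon>(3)[OF x] right_ideal_self[OF ring_axioms xR] by simp
    then have "x \<in> ?I (\<epsilon> x)" using xR unfolding right_ideal_def by blast
    then show "?I x = ?I (\<epsilon> x)"
      using right_ideal_subset_iff[OF ring_axioms xR \<epsilon>R[OF x]]
        right_ideal_subset_iff[OF ring_axioms \<epsilon>R[OF x] xR] \<epsilon>(1)[OF x] by (intro subset_antisym) simp_all
  next
    fix x y assume x: "x \<in> X" and y: "y \<in> X" and le: "?I x \<subseteq> ?I y"
    \<comment> \<open>The complement of the larger ideal is the smaller one, so 1 -
      \<open>\<epsilon> y\<close> is killed by \<open>\<epsilon> x\<close>. This gives one half of
      the idempotent order; the other half comes from the inclusion of the ideals.\<close>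
    have "f (?I y) \<subseteq> f (?I x)"
      by (rule f'(2)[THEN bspec, OF imageI[OF x], THEN bspec, OF imageI[OF y], THEN mp, OF le])
    then have "\<epsilon> x \<otimes>\<^bsub>R\<^esub> (\<one>\<^bsub>R\<^esub> \<ominus>\<^bsub>R\<^esub> \<epsilon> y) = \<zero>\<^bsub>R\<^esub>" using \<epsilon>(2)[OF y] \<epsilon>(4)[OF x] by blast
    then have "\<epsilon> x \<ominus>\<^bsub>R\<^esub> \<epsilon> x \<otimes>\<^bsub>R\<^esub> \<epsilon> y = \<zero>\<^bsub>R\<^esub>"
      using \<epsilon>R[OF x] \<epsilon>R[OF y] by (simp add: a_minus_def r_distr r_minus)
    then have "\<epsilon> x = \<epsilon> x \<otimes>\<^bsub>R\<^esub> \<epsilon> y"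
      using \<epsilon>R[OF x] \<epsilon>R[OF y]
      by (metis a_minus_def a_inv_closed m_closed minus_equality minus_minus)
    moreover have "\<epsilon> x = \<epsilon> y \<otimes>\<^bsub>R\<^esub> \<epsilon> x" using \<epsilon>(1)[OF x] \<epsilon>(3)[OF y] le by auto
    ultimately show "idem_le R (\<epsilon> x) (\<epsilon> y)" by (simp add: idem_le_def)
  qed
  then show ?thesis by (rule exI[of _ \<epsilon>])
qed

section \<open>Nonexistence\<close>

lemma finite_vars: "finite (vars t)"
  by (induction t) auto

text \<open>The argument works over any nonempty well-order in which every countable set has a
  strict upper bound.\<close>

lemma no_ring_Banaschewski:
  fixes E :: "('f::field, nat) tm rel" and r :: "'i rel"
  assumes E: "qinv_variety E" and q: "RF_quasi_inversion q" and RF: "RF q \<in> Mod E"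
    and wo: "Well_order r" and ne: "Field r \<noteq> {}"
    and bounded: "\<And>K. countable K \<Longrightarrow> K \<subseteq> Field r \<Longrightarrow> \<exists>a\<in>Field r. \<forall>b\<in>K. (b, a) \<in> r \<and> b \<noteq> a"
  shows "\<not> ring_partial_Banaschewski (ring_of (RV E r)) (tilde E r ` Field r) \<epsilon>"
proof
  interpret wo_rel r using wo by (simp add: wo_rel_def)
  let ?P = "RV E r" and ?R = "ring_of (RV E r)" and ?G = "Field r"
  let ?c = "\<lambda>t. pres_rel E (Field r) (chain_rels r) `` {t}"
  assume B: "ring_partial_Banaschewski ?R (tilde E r ` ?G) \<epsilon>"
  have ring: "ring ?R"
    using Mod_subset_Reg[OF E] presented_in_Mod Reg_regular_ring
    unfolding RV_def regular_ring_def by blast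
  have car: "X \<in> carrier ?R \<longleftrightarrow> (\<exists>t\<in>terms_over ?G. X = ?c t)" for X
    by (auto simp: RV_def presented_consts quotient_def ring_of_simps)
  have mult: "?c s \<otimes>\<^bsub>?R\<^esub> ?c t = ?c (TTimes s t)" if "s \<in> terms_over ?G" "t \<in> terms_over ?G" for s t
    using presented_ops(2)[OF that] by (simp add: ring_of_simps RV_def)
  have VG: "Var \<xi> \<in> terms_over ?G" if "\<xi> \<in> ?G" for \<xi> using that by (simp add: terms_over_def)
  have TG: "TTimes s t \<in> terms_over ?G" if "s \<in> terms_over ?G" "t \<in> terms_over ?G"
    for s t :: "('f, 'i) tm" using that by (simp add: terms_over_def)
  have tilde: "tilde E r \<xi> = ?c (Var \<xi>)" for \<xi> by (simp add: tilde_def)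
  have tildeR: "tilde E r \<xi> \<in> carrier ?R" if "\<xi> \<in> ?G" for \<xi>
    unfolding car tilde using VG[OF that] by blast
  have rel: "tilde E r \<xi> = tilde E r \<eta> \<otimes>\<^bsub>?R\<^esub> tilde E r \<xi>" if "(\<xi>, \<eta>) \<in> r" for \<xi> \<eta>
  proof -
    have G: "\<xi> \<in> ?G" "\<eta> \<in> ?G" using that by (auto simp: Field_def)
    have "pres_cong E ?G (chain_rels r) (Var \<xi>) (TTimes (Var \<eta>) (Var \<xi>))"
      using that G by (intro pres_cong.rel VG TG) (auto simp: chain_rels_def)
    then show ?thesis
      using pres_class_eq[OF VG[OF G(1)] TG[OF VG[OF G(2)] VG[OF G(1)]]] mult[OF VG[OF G(2)] VG[OF G(1)]]
      unfolding tilde by simp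
  qed
  have idem: "\<epsilon> (tilde E r \<xi>) \<in> idempotents ?R"
    and ideal: "right_ideal ?R (tilde E r \<xi>) = right_ideal ?R (\<epsilon> (tilde E r \<xi>))" if "\<xi> \<in> ?G" for \<xi>
    using B that unfolding ring_partial_Banaschewski_def by blast+
  have "\<exists>t. t \<in> terms_over ?G \<and> \<epsilon> (tilde E r \<xi>) = ?c t" if "\<xi> \<in> ?G" for \<xi>
    using idem[OF that] car by (auto simp: idempotents_def)
  then obtain T where T: "\<And>\<xi>. \<xi> \<in> ?G \<Longrightarrow> T \<xi> \<in> terms_over ?G"
    and \<epsilon>T: "\<And>\<xi>. \<xi> \<in> ?G \<Longrightarrow> \<epsilon> (tilde E r \<xi>) = ?c (T \<xi>)" by metis
  \<comment> \<open>The properties of \<open>\<epsilon>\<close> are turned into equations between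
    classes of terms, the form in which evaluation in the matrix algebra can transport them.\<close>
  have eq1: "?c (TTimes (T \<xi>) (Var \<xi>)) = ?c (Var \<xi>)" if \<xi>: "\<xi> \<in> ?G" for \<xi>
    using mem_right_ideal_idempotent[OF ring idem[OF \<xi>]
        right_ideal_self[OF ring tildeR[OF \<xi>], unfolded ideal[OF \<xi>]]]
      mult[OF T[OF \<xi>] VG[OF \<xi>]]
    unfolding \<epsilon>T[OF \<xi>] unfolding tilde by simp
  have eq2: "?c (TTimes (Var \<xi>) (T \<xi>)) = ?c (T \<xi>)" if \<xi>: "\<xi> \<in> ?G" for \<xi>
  proof -
    \<comment> \<open>Idempotence of a generator is the reflexive case of the chain
      relations.\<close>
    have "tilde E r \<xi> \<in> idempotents ?R"
      using tildeR[OF \<xi>] rel[of \<xi> \<xi>] REFL \<xi> unfolding idempotents_def refl_on_def by auto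
    moreover have "\<epsilon> (tilde E r \<xi>) \<in> right_ideal ?R (\<epsilon> (tilde E r \<xi>))"
      using idem[OF \<xi>] by (intro right_ideal_self[OF ring]) (simp add: idempotents_def)
    ultimately have "tilde E r \<xi> \<otimes>\<^bsub>?R\<^esub> \<epsilon> (tilde E r \<xi>) = \<epsilon> (tilde E r \<xi>)"
      using mem_right_ideal_idempotent[OF ring] ideal[OF \<xi>] by simp
    then show ?thesis
      using mult[OF VG[OF \<xi>] T[OF \<xi>]] unfolding \<epsilon>T[OF \<xi>] unfolding tilde by simp
  qed
  have eq3: "?c (T \<xi>) = ?c (TTimes (T \<xi>) (T \<eta>))" if "(\<xi>, \<eta>) \<in> r" for \<xi> \<eta>
  proof -
    have G: "\<xi> \<in> ?G" "\<eta> \<in> ?G" using that by (auto simp: Field_def)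
    have "tilde E r \<xi> \<in> right_ideal ?R (tilde E r \<eta>)"
      using rel[OF that] tildeR[OF G(1)] unfolding right_ideal_def by blast
    then have "idem_le ?R (\<epsilon> (tilde E r \<xi>)) (\<epsilon> (tilde E r \<eta>))"
      using B G right_ideal_subset_iff[OF ring tildeR[OF G(1)] tildeR[OF G(2)]]
      unfolding ring_partial_Banaschewski_def by blast
    then have "\<epsilon> (tilde E r \<xi>) = \<epsilon> (tilde E r \<xi>) \<otimes>\<^bsub>?R\<^esub> \<epsilon> (tilde E r \<eta>)"
      unfolding idem_le_def by (rule conjunct1)
    then show ?thesis unfolding \<epsilon>T[OF G(1)] \<epsilon>T[OF G(2)] mult[OF T[OF G(1)] T[OF G(2)]] .
  qed
  have vars_T: "finite (vars (T \<xi>)) \<and> vars (T \<xi>) \<subseteq> ?G" if "\<xi> \<in> ?G" for \<xi>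
    using T[OF that] finite_vars by (auto simp: terms_over_def)
  obtain \<xi> \<eta> where \<xi>\<eta>: "\<xi> \<in> ?G" "\<eta> \<in> ?G" "(\<xi>, \<eta>) \<in> r" "\<xi> \<noteq> \<eta>"
    and below: "\<And>s. s \<in> vars (T \<xi>) \<Longrightarrow> (s, \<eta>) \<in> r \<and> s \<noteq> \<eta>"
    and gap: "\<And>s. s \<in> vars (T \<eta>) \<Longrightarrow> (\<xi>, s) \<in> r \<Longrightarrow> (\<eta>, s) \<in> r"
    using separated_pair[of r "\<lambda>\<xi>. vars (T \<xi>)", OF wo ne bounded vars_T] by blast
  define v :: "'i \<Rightarrow> 'f^3^3" where
    "v \<alpha> = (if (\<eta>, \<alpha>) \<in> r then matB else if (\<xi>, \<alpha>) \<in> r then matA else 0)" for \<alpha>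
  let ?e = "eval (RF q) v"
  have e_simps: "?e (TTimes s t) = ?e s ** ?e t" "?e (Var \<alpha>) = v \<alpha>" for s t \<alpha>
    by (simp_all add: RF_def)
  \<comment> \<open>Along the chain the values pass from 0 to A to B, so only AA = A, BA = A, BB = B
    and products with right factor 0 occur.\<close>
  have v_rel: "v \<alpha> = v \<beta> ** v \<alpha>" if "(\<alpha>, \<beta>) \<in> r" for \<alpha> \<beta>
  proof -
    have up: "(\<zeta>, \<alpha>) \<in> r \<Longrightarrow> (\<zeta>, \<beta>) \<in> r" for \<zeta> using that TRANS unfolding trans_def by blast
    show ?thesis using up[of \<xi>] up[of \<eta>] by (auto simp: v_def matA_matB)
  qed
  have e_eq: "?e s = ?e t" if "?c s = ?c t" "s \<in> terms_over ?G" "t \<in> terms_over ?G" for s t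
  proof (rule pres_cong_sound[OF RF])
    show "v ` ?G \<subseteq> carrier (RF q)" by (simp add: RF_def)
    show "?e s = ?e t" if "(s, t) \<in> chain_rels r" for s t
      using that v_rel by (auto simp: chain_rels_def e_simps simp del: eval.simps)
    show "pres_cong E ?G (chain_rels r) s t" using that pres_class_eq by blast
  qed
  \<comment> \<open>Write e for the evaluated term and M for \<open>v \<zeta>\<close>. The first two
    equations become eM = M and Me = e, and membership in the algebra generated by M gives eM = Me;
    hence e = M.\<close>
  have image: "?e (T \<zeta>) = v \<zeta>"
    if "\<zeta> \<in> ?G" "?e (T \<zeta>) \<in> gen_subalgebra (v \<zeta>)" for \<zeta>
    using e_eq[OF eq1[OF that(1)] TG[OF T[OF that(1)] VG[OF that(1)]] VG[OF that(1)]]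
      e_eq[OF eq2[OF that(1)] TG[OF VG[OF that(1)] T[OF that(1)]] T[OF that(1)]]
      gen_subalgebra_commute[OF that(2)]
    by (simp add: e_simps del: eval.simps)
  have zero: "0 \<in> gen_subalgebra M" for M :: "'f^3^3"
    by (rule unital_subalgebra_closed(1)[OF gen_subalgebra_unital])
  have \<eta>\<xi>: "(\<eta>, \<xi>) \<notin> r" using \<xi>\<eta> ANTISYM unfolding antisym_def by blast
  have v\<xi>: "v \<xi> = matA" and v\<eta>: "v \<eta> = matB"
    using \<xi>\<eta> \<eta>\<xi> REFL unfolding v_def refl_on_def by auto
  have "?e (T \<xi>) \<in> gen_subalgebra matA"
  proof (rule RF_eval_gen_subalgebra[OF q disjI1[OF HOL.refl]])
    fix s assume "s \<in> vars (T \<xi>)"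
    then have "(\<eta>, s) \<notin> r" using below ANTISYM unfolding antisym_def by blast
    then show "v s \<in> gen_subalgebra matA" by (simp add: v_def gen_subalgebra_generator zero)
  qed
  then have "?e (T \<xi>) = matA" using image[OF \<xi>\<eta>(1)] v\<xi> by simp
  \<comment> \<open>By the gap condition each variable of this term is either at or above
    \<open>\<eta>\<close>, with value B, or strictly below \<open>\<xi>\<close>, with value 0; the
    value A never occurs.\<close>
  moreover have "?e (T \<eta>) \<in> gen_subalgebra matB"
    using gap by (intro RF_eval_gen_subalgebra[OF q disjI2[OF HOL.refl]])
      (auto simp: v_def gen_subalgebra_generator zero)
  then have "?e (T \<eta>) = matB" using image[OF \<xi>\<eta>(2)] v\<eta> by simp
  moreover have "?e (T \<xi>) = ?e (T \<xi>) ** ?e (T \<eta>)"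
    using e_eq[OF eq3[OF \<xi>\<eta>(3)] T[OF \<xi>\<eta>(1)] TG[OF T[OF \<xi>\<eta>(1)] T[OF \<xi>\<eta>(2)]]]
    by (simp add: e_simps del: eval.simps)
  ultimately show False using matA_matB(4) by metis
qed

theorem proposition4p4:
  fixes E :: "('f::field, nat) tm rel"
    and q :: "'f^3^3 \<Rightarrow> 'f^3^3"
  assumes "countable (UNIV :: 'f set)"
    and "qinv_variety E"
    and "RF_quasi_inversion q"
    and "RF q \<in> Mod E"
  shows
    "((\<nexists>\<epsilon>. ring_partial_Banaschewski (ring_of (RV E omega1)) (tilde E omega1 ` Field omega1) \<epsilon>) \<and>
      (\<nexists>\<epsilon>. ring_Banaschewski (ring_of (RV E omega1)) \<epsilon>)) \<and>
     ((\<nexists>f. lattice_partial_Banaschewski (ideal_lattice (ring_of (RV E omega1)))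
             {right_ideal (ring_of (RV E omega1)) (tilde E omega1 \<xi>) | \<xi>. \<xi> \<in> Field omega1} f) \<and>
      (\<nexists>f. lattice_Banaschewski (ideal_lattice (ring_of (RV E omega1))) f))"
proof -
  let ?R = "ring_of (RV E omega1)" and ?X = "tilde E omega1 ` Field omega1"
  let ?Y = "{right_ideal ?R (tilde E omega1 \<xi>) | \<xi>. \<xi> \<in> Field omega1}"
  have Y: "?Y = right_ideal ?R ` ?X" by auto
  have reg: "regular_ring ?R"
    using Mod_subset_Reg[OF assms(2)] presented_in_Mod Reg_regular_ring unfolding RV_def by blast
  have X: "?X \<subseteq> carrier ?R"
    unfolding RV_def ring_of_simps presented_consts tilde_def
    by (auto simp: terms_over_def intro!: quotientI)
  have ring: "\<not> ring_partial_Banaschewski ?R ?X \<epsilon>" for \<epsilon>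
    using infinite_Field_omega1
    by (intro no_ring_Banaschewski[OF assms(2-4) omega1_Well_order _ omega1_countable_bounded]) auto
  have lattice: "\<not> lattice_partial_Banaschewski (ideal_lattice ?R) ?Y f" for f
    using lattice_imp_ring_Banaschewski[OF reg X] ring unfolding Y by blast
  \<comment> \<open>A function on the whole ring restricts to the generators; the lattice case below
    restricts to the ideals they generate.\<close>
  have "\<not> ring_Banaschewski ?R \<epsilon>" for \<epsilon>
    using ring[of \<epsilon>] X unfolding ring_Banaschewski_def ring_partial_Banaschewski_def by (meson subsetD)
  moreover have "?Y \<subseteq> carrier (ideal_lattice ?R)"
    using X unfolding Y ideal_lattice_simps by (rule image_mono)
  then have "\<not> lattice_Banaschewski (ideal_lattice ?R) f" for f
    using lattice[of f] unfolding lattice_Banaschewski_def lattice_partial_Banaschewski_def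
    by (meson subsetD)
  ultimately show ?thesis using ring lattice by blast
qed

end
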